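(* Let $k\ge 3$. If $G$ is a finite $k$-regular graph with (vertex) connectivity $1$, then $G$ is $k$-swappable.
   Context: A list-assignment $L$ assigns to each vertex $v$ a set $L(v)$ of colors; an $L$-coloring is a proper coloring $\varphi$ with $\varphi(v)\in L(v)$. An $\alpha,\beta$-Kempe swap at a vertex $u$ with $\varphi(u)\in\{\alpha,\beta\}$ interchanges $\alpha$ and $\beta$ on the component containing $u$ of the subgraph induced by vertices colored $\alpha$ or $\beta$; it is $L$-valid if the result is again an $L$-coloring. Two $L$-colorings are $L$-equivalent if one is obtained from the other by a sequence of $L$-valid Kempe swaps. $G$ is $L$-swappable if it has an $L$-coloring and all its $L$-colorings are pairwise $L$-equivalent. A $k$-assignment has $|L(v)|=k$ for all $v$; $G$ is $k$-swappable if it is $L$-swappable for every $k$-assignment $L$. *)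

theory Defs
  imports "Graph_Theory.Digraph_Component" "HOL-Library.FuncSet" "HOL-Combinatorics.Transposition"
begin

text \<open>
  A finite simple graph is a \<^locale>\<open>graph\<close>: a finite symmetric digraph without loops or
  parallel arcs, an edge \<open>uv\<close> being the two arcs from \<open>u\<close> to \<open>v\<close> and from \<open>v\<close> to \<open>u\<close>.
  Hence the out-degree is the usual degree.
\<close>

definition regular_graph :: "('a, 'b) pre_digraph \<Rightarrow> nat \<Rightarrow> bool" where
  "regular_graph G k \<longleftrightarrow> (\<forall>v \<in> verts G. out_degree G v = k)"

text \<open>
  The least number of vertices whose removal leaves a disconnected graph or a single vertex; the
  second alternative gives the complete graph on \<open>n\<close> vertices connectivity \<open>n - 1\<close>.
  The library's \<^const>\<open>connected\<close> is false for the null graph, so the removal of all vertices is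
  also admitted, but it is never minimal unless the graph itself is null.
\<close>

definition vertex_connectivity :: "('a, 'b) pre_digraph \<Rightarrow> nat" where
  "vertex_connectivity G = (LEAST n. \<exists>S \<subseteq> verts G. card S = n \<and>
     (\<not> connected (G \<restriction> (verts G - S)) \<or> card (verts G - S) = 1))"

text \<open>
  Colorings are extensional functions on the vertex set, so that equality of colorings means
  agreement on all vertices.
\<close>

definition list_colorings :: "('a, 'b) pre_digraph \<Rightarrow> ('a \<Rightarrow> 'c set) \<Rightarrow> ('a \<Rightarrow> 'c) set" where
  "list_colorings G L = {\<phi> \<in> PiE (verts G) L. \<forall>u v. u \<rightarrow>\<^bsub>G\<^esub> v \<longrightarrow> \<phi> u \<noteq> \<phi> v}"

text \<open>
  In a symmetric digraph the strongly connected component of a vertex is its connected component.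
\<close>

definition kempe_component ::
    "('a, 'b) pre_digraph \<Rightarrow> ('a \<Rightarrow> 'c) \<Rightarrow> 'c \<Rightarrow> 'c \<Rightarrow> 'a \<Rightarrow> 'a set" where
  "kempe_component G \<phi> \<alpha> \<beta> u =
     pre_digraph.scc_of (G \<restriction> {v \<in> verts G. \<phi> v \<in> {\<alpha>, \<beta>}}) u"

definition kempe_swap ::
    "('a, 'b) pre_digraph \<Rightarrow> 'c \<Rightarrow> 'c \<Rightarrow> 'a \<Rightarrow> ('a \<Rightarrow> 'c) \<Rightarrow> 'a \<Rightarrow> 'c" where
  "kempe_swap G \<alpha> \<beta> u \<phi> =
     (\<lambda>v. if v \<in> kempe_component G \<phi> \<alpha> \<beta> u then transpose \<alpha> \<beta> (\<phi> v) else \<phi> v)"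

definition valid_swaps ::
    "('a, 'b) pre_digraph \<Rightarrow> ('a \<Rightarrow> 'c set) \<Rightarrow> (('a \<Rightarrow> 'c) \<times> ('a \<Rightarrow> 'c)) set" where
  "valid_swaps G L = {(\<phi>, \<psi>). \<phi> \<in> list_colorings G L \<and> \<psi> \<in> list_colorings G L \<and>
     (\<exists>u \<in> verts G. \<exists>\<alpha> \<beta>. \<phi> u \<in> {\<alpha>, \<beta>} \<and> \<psi> = kempe_swap G \<alpha> \<beta> u \<phi>)}"

definition list_equivalent ::
    "('a, 'b) pre_digraph \<Rightarrow> ('a \<Rightarrow> 'c set) \<Rightarrow> ('a \<Rightarrow> 'c) \<Rightarrow> ('a \<Rightarrow> 'c) \<Rightarrow> bool" where
  "list_equivalent G L \<phi> \<psi> \<longleftrightarrow> (\<phi>, \<psi>) \<in> (valid_swaps G L)\<^sup>*"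

definition list_swappable :: "('a, 'b) pre_digraph \<Rightarrow> ('a \<Rightarrow> 'c set) \<Rightarrow> bool" where
  "list_swappable G L \<longleftrightarrow> list_colorings G L \<noteq> {} \<and>
     (\<forall>\<phi> \<in> list_colorings G L. \<forall>\<psi> \<in> list_colorings G L. list_equivalent G L \<phi> \<psi>)"

definition k_assignment :: "('a, 'b) pre_digraph \<Rightarrow> nat \<Rightarrow> ('a \<Rightarrow> 'c set) \<Rightarrow> bool" where
  "k_assignment G k L \<longleftrightarrow> (\<forall>v \<in> verts G. finite (L v) \<and> card (L v) = k)"

text \<open>
  The type of colors is an explicit parameter, since HOL cannot quantify over it inside a definition.
\<close>

definition k_swappable :: "'c itself \<Rightarrow> nat \<Rightarrow> ('a, 'b) pre_digraph \<Rightarrow> bool" where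
  "k_swappable C k G \<longleftrightarrow> (\<forall>L :: 'a \<Rightarrow> 'c set. k_assignment G k L \<longrightarrow> list_swappable G L)"

end

theory Submission
  imports Defs "HOL-Combinatorics.Permutations"
begin

text \<open>
  If some colors are fixed and every component of the rest contains a vertex with more available
  colors than uncolored neighbors, then the argument of Las Vergnas and Meyniel shows that the
  extensions exist and are all equivalent. Such slack arises at a vertex two of whose fixed neighbors
  agree, or one of whose fixed neighbors has a color missing from its list.

  Take two disjoint leaf blocks. If the lists on a leaf block \<open>C \<union> {x}\<close> with cut vertex \<open>x\<close> are all
  equal, then the colors on it can be permuted freely, and swaps of the rest of the graph extend to
  it. Otherwise some \<open>w \<in> C\<close> has a color missing from the list of a neighbor \<open>v\<close>. Colorings in which
  such a misfit occurs in one of the two blocks are all equivalent, because misfits in different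
  blocks can be prescribed simultaneously. It remains to lead an arbitrary coloring to a misfit.
  By counting, two neighbors of \<open>x\<close> have the same color \<open>c\<close> unless there is slack at once. If they
  lie on the same side of \<open>x\<close>, then the other side can be recolored at will. So let \<open>y \<in> C\<close> be one of
  them and the other outside. Fix \<open>y\<close> and everything outside \<open>C \<union> {x}\<close>; then all colorings of the
  connected rest \<open>H\<close> are equivalent. If none of them has a misfit, an induction along the
  cut vertices of \<open>H\<close> shows that the lists are constant on \<open>H\<close>, and then \<open>y\<close> itself can be recolored
  to a misfit.
\<close>

section \<open>Colorings and swaps on closed sets\<close>

locale sym_irrefl =
  fixes E :: "'a \<Rightarrow> 'a \<Rightarrow> bool"
  assumes sym: "E u v \<Longrightarrow> E v u"
    and irrefl: "\<not> E v v"
begin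

definition nbrs :: "'a set \<Rightarrow> 'a \<Rightarrow> 'a set" where
  "nbrs W v = {u \<in> W. E v u}"

text \<open>These are the unions of connected components of the subgraph induced by
  \<open>W\<close>. Reasoning with them replaces paths and reachability.\<close>

definition closed_in :: "'a set \<Rightarrow> 'a set \<Rightarrow> bool" where
  "closed_in W S \<longleftrightarrow> S \<subseteq> W \<and> (\<forall>s \<in> S. \<forall>t \<in> W. E s t \<longrightarrow> t \<in> S)"

text \<open>The empty set counts as connected, so nonemptiness is stated separately where it
  matters.\<close>

definition connected_set :: "'a set \<Rightarrow> bool" where
  "connected_set W \<longleftrightarrow> (\<forall>S. S \<noteq> {} \<longrightarrow> closed_in W S \<longrightarrow> S = W)"

text \<open>Values off \<open>W\<close> are unconstrained, so one function can be a coloring of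
  several sets at once without being restricted.\<close>

definition col :: "'a set \<Rightarrow> ('a \<Rightarrow> 'c set) \<Rightarrow> ('a \<Rightarrow> 'c) set" where
  "col W L = {\<phi>. (\<forall>v \<in> W. \<phi> v \<in> L v) \<and> (\<forall>u \<in> W. \<forall>v \<in> W. E u v \<longrightarrow> \<phi> u \<noteq> \<phi> v)}"

text \<open>
  A step interchanges two colors on an arbitrary union of Kempe components, and may change the
  values outside \<open>W\<close> at will; so colorings that agree on \<open>W\<close> are one step apart.
\<close>

definition step :: "'a set \<Rightarrow> ('a \<Rightarrow> 'c set) \<Rightarrow> (('a \<Rightarrow> 'c) \<times> ('a \<Rightarrow> 'c)) set" where
  "step W L = {(\<phi>, \<psi>). \<phi> \<in> col W L \<and> \<psi> \<in> col W L \<and>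
     (\<exists>\<alpha> \<beta> K. closed_in {v \<in> W. \<phi> v \<in> {\<alpha>, \<beta>}} K \<and>
       (\<forall>v \<in> W. \<psi> v = (if v \<in> K then transpose \<alpha> \<beta> (\<phi> v) else \<phi> v)))}"

abbreviation eqv :: "'a set \<Rightarrow> ('a \<Rightarrow> 'c set) \<Rightarrow> ('a \<Rightarrow> 'c) \<Rightarrow> ('a \<Rightarrow> 'c) \<Rightarrow> bool" where
  "eqv W L \<phi> \<psi> \<equiv> (\<phi>, \<psi>) \<in> (step W L)\<^sup>*"

lemma finite_nbrs [simp]: "finite W \<Longrightarrow> finite (nbrs W v)"
  by (simp add: nbrs_def)

lemma closed_in_Diff: "closed_in W S \<Longrightarrow> closed_in W (W - S)"
  unfolding closed_in_def using sym by blast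

lemma connected_setD: "connected_set W \<Longrightarrow> S \<noteq> {} \<Longrightarrow> closed_in W S \<Longrightarrow> S = W"
  unfolding connected_set_def by blast

text \<open>The level set of \<open>f\<close> through \<open>a\<close> is closed in
  \<open>W\<close>.\<close>

lemma connected_set_const:
  assumes "connected_set W" "\<And>u v. u \<in> W \<Longrightarrow> v \<in> W \<Longrightarrow> E u v \<Longrightarrow> f u = f v" "a \<in> W" "b \<in> W"
  shows "f a = f b"
proof -
  have "closed_in W {u \<in> W. f u = f a}"
    unfolding closed_in_def using assms(2) by fastforce
  then have "{u \<in> W. f u = f a} = W"
    using assms(3) by (intro connected_setD[OF assms(1)]) auto
  then have "b \<in> {u \<in> W. f u = f a}" using assms(4) by blast
  then show ?thesis by simp
qed

lemma col_in: "\<phi> \<in> col W L \<Longrightarrow> v \<in> W \<Longrightarrow> \<phi> v \<in> L v"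
  by (simp add: col_def)

lemma col_ne: "\<phi> \<in> col W L \<Longrightarrow> u \<in> W \<Longrightarrow> v \<in> W \<Longrightarrow> E u v \<Longrightarrow> \<phi> u \<noteq> \<phi> v"
  by (simp add: col_def)

lemma col_subset: "\<phi> \<in> col W L \<Longrightarrow> U \<subseteq> W \<Longrightarrow> \<phi> \<in> col U L"
  by (auto simp: col_def)

lemma col_cong: "(\<And>v. v \<in> W \<Longrightarrow> \<phi> v = \<psi> v) \<Longrightarrow> \<phi> \<in> col W L \<longleftrightarrow> \<psi> \<in> col W L"
  by (auto simp: col_def)

lemma transpose_in_pair: "a \<in> {\<alpha>, \<beta>} \<Longrightarrow> transpose \<alpha> \<beta> a \<in> {\<alpha>, \<beta>}"
  by auto

text \<open>Properness is automatic: an edge leaving \<open>K\<close> joins a color of the pair to a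
  color outside it, and on all other edges injectivity of the transposition suffices. Only list
  membership has to be checked.\<close>

lemma stepI:
  assumes \<phi>: "\<phi> \<in> col W L"
    and K: "closed_in {v \<in> W. \<phi> v \<in> {\<alpha>, \<beta>}} K"
    and L: "\<And>v. v \<in> K \<Longrightarrow> transpose \<alpha> \<beta> (\<phi> v) \<in> L v"
    and \<psi>: "\<And>v. v \<in> W \<Longrightarrow> \<psi> v = (if v \<in> K then transpose \<alpha> \<beta> (\<phi> v) else \<phi> v)"
  shows "(\<phi>, \<psi>) \<in> step W L"
proof -
  have mixed: "\<psi> u \<noteq> \<psi> v" if "u \<in> W" "v \<in> W" "E u v" "u \<in> K" "v \<notin> K" for u v
  proof -
    have u: "\<phi> u \<in> {\<alpha>, \<beta>}" using K that unfolding closed_in_def by auto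
    have v: "\<phi> v \<notin> {\<alpha>, \<beta>}" using K that unfolding closed_in_def by auto
    show ?thesis using transpose_in_pair[OF u] v \<psi>[OF that(1)] \<psi>[OF that(2)] that(4,5) by metis
  qed
  have "\<psi> u \<noteq> \<psi> v" if "u \<in> W" "v \<in> W" "E u v" for u v
  proof (cases "u \<in> K \<longleftrightarrow> v \<in> K")
    case True
    then show ?thesis using \<psi>[OF that(1)] \<psi>[OF that(2)] col_ne[OF \<phi> that]
      by (auto dest: transpose_eq_imp_eq)
  next
    case False
    then show ?thesis using mixed[OF that] mixed[OF that(2,1) sym[OF that(3)]] by metis
  qed
  moreover have "\<psi> v \<in> L v" if "v \<in> W" for v
    using L \<psi>[OF that] col_in[OF \<phi> that] by auto
  ultimately have "\<psi> \<in> col W L" by (auto simp: col_def)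
  with \<phi> K \<psi> show ?thesis unfolding step_def by blast
qed

lemma step_col: "(\<phi>, \<psi>) \<in> step W L \<Longrightarrow> \<psi> \<in> col W L"
  by (simp add: step_def)

text \<open>A swap preserves the set of vertices colored \<alpha> or \<beta>, so the same
  \<open>K\<close> undoes it.\<close>

lemma step_sym: "(\<phi>, \<psi>) \<in> step W L \<Longrightarrow> (\<psi>, \<phi>) \<in> step W L"
proof -
  assume "(\<phi>, \<psi>) \<in> step W L"
  then obtain \<alpha> \<beta> K where \<phi>: "\<phi> \<in> col W L" and \<psi>: "\<psi> \<in> col W L"
    and K: "closed_in {v \<in> W. \<phi> v \<in> {\<alpha>, \<beta>}} K"
    and eq: "\<forall>v \<in> W. \<psi> v = (if v \<in> K then transpose \<alpha> \<beta> (\<phi> v) else \<phi> v)"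
    unfolding step_def by blast
  have KW: "K \<subseteq> W" using K unfolding closed_in_def by auto
  have "\<psi> v \<in> {\<alpha>, \<beta>} \<longleftrightarrow> \<phi> v \<in> {\<alpha>, \<beta>}" if "v \<in> W" for v
    using eq that by (auto simp: transpose_eq_iff)
  then have "{v \<in> W. \<psi> v \<in> {\<alpha>, \<beta>}} = {v \<in> W. \<phi> v \<in> {\<alpha>, \<beta>}}" by blast
  with K have "closed_in {v \<in> W. \<psi> v \<in> {\<alpha>, \<beta>}} K" by simp
  then show ?thesis
  proof (rule stepI[OF \<psi>])
    show "transpose \<alpha> \<beta> (\<psi> v) \<in> L v" if "v \<in> K" for v
      using eq that KW col_in[OF \<phi>, of v] by auto
    show "\<phi> v = (if v \<in> K then transpose \<alpha> \<beta> (\<psi> v) else \<psi> v)" if "v \<in> W" for v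
      using eq that by auto
  qed
qed

lemma eqv_sym: "eqv W L \<phi> \<psi> \<Longrightarrow> eqv W L \<psi> \<phi>"
  using step_sym by (metis symI symD sym_rtrancl)

lemma eqv_trans: "eqv W L \<phi> \<psi> \<Longrightarrow> eqv W L \<psi> \<chi> \<Longrightarrow> eqv W L \<phi> \<chi>"
  by (rule rtrancl_trans)

lemma eqv_col: "eqv W L \<phi> \<psi> \<Longrightarrow> \<phi> \<in> col W L \<Longrightarrow> \<psi> \<in> col W L"
  by (induction rule: rtrancl_induct) (auto simp: step_def)

lemma eqv_agree:
  assumes "\<phi> \<in> col W L" "\<And>v. v \<in> W \<Longrightarrow> \<psi> v = \<phi> v"
  shows "eqv W L \<phi> \<psi>"
proof -
  have "(\<phi>, \<psi>) \<in> step W L"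
    using assms by (intro stepI[where K = "{}"]) (auto simp: closed_in_def)
  then show ?thesis by blast
qed

text \<open>As no neighbor of \<open>v\<close> has color \<gamma>, the vertex \<open>v\<close> alone
  is a Kempe component for its own color and \<gamma>.\<close>

lemma recolor_step:
  assumes "\<phi> \<in> col W L" "v \<in> W" "\<gamma> \<in> L v" "\<And>u. u \<in> W \<Longrightarrow> E v u \<Longrightarrow> \<phi> u \<noteq> \<gamma>"
  shows "(\<phi>, \<phi>(v := \<gamma>)) \<in> step W L"
proof (rule stepI[where K = "{v}" and \<alpha> = "\<phi> v" and \<beta> = \<gamma>])
  show "closed_in {u \<in> W. \<phi> u \<in> {\<phi> v, \<gamma>}} {v}"
    unfolding closed_in_def using assms(2,4) col_ne[OF assms(1,2)] by fastforce
qed (use assms in auto)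

section \<open>Degenerate list assignments\<close>

text \<open>
  The argument of Las Vergnas and Meyniel: \<open>v\<close> joins the swapped set if it can, and otherwise it
  has a spare color outside \<open>{\<alpha>, \<beta>}\<close>, which takes it out of the way.
\<close>

lemma step_extend_vertex:
  assumes fin: "finite W" and vW: "v \<in> W"
    and deg: "card (nbrs W v) < card (L v)"
    and st: "(\<phi>', \<psi>') \<in> step (W - {v}) L"
    and \<phi>: "\<phi> \<in> col W L" and agree: "\<And>u. u \<in> W - {v} \<Longrightarrow> \<phi> u = \<phi>' u"
  shows "\<exists>\<psi>. \<psi> \<in> col W L \<and> (\<forall>u \<in> W - {v}. \<psi> u = \<psi>' u) \<and> eqv W L \<phi> \<psi>"
proof -
  let ?U = "W - {v}"
  obtain \<alpha>0 \<beta>0 K where \<psi>': "\<psi>' \<in> col ?U L"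
    and K0: "closed_in {u \<in> ?U. \<phi>' u \<in> {\<alpha>0, \<beta>0}} K"
    and eq0: "\<forall>u \<in> ?U. \<psi>' u = (if u \<in> K then transpose \<alpha>0 \<beta>0 (\<phi>' u) else \<phi>' u)"
    using st unfolding step_def by blast
  \<comment> \<open>The pair is ordered so that \<open>v\<close>, if it has one of the two colors,
    has \<alpha>.\<close>
  define \<alpha> \<beta> where "\<alpha> = (if \<phi> v = \<beta>0 then \<beta>0 else \<alpha>0)" and "\<beta> = (if \<phi> v = \<beta>0 then \<alpha>0 else \<beta>0)"
  have pair: "{\<alpha>0, \<beta>0} = {\<alpha>, \<beta>}" and tr: "transpose \<alpha>0 \<beta>0 = transpose \<alpha> \<beta>"
    and v\<alpha>: "\<phi> v \<in> {\<alpha>, \<beta>} \<Longrightarrow> \<phi> v = \<alpha>"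
    by (auto simp: \<alpha>_def \<beta>_def transpose_commute)
  have "{u \<in> ?U. \<phi>' u \<in> {\<alpha>, \<beta>}} = {u \<in> ?U. \<phi> u \<in> {\<alpha>, \<beta>}}" using agree by auto
  with K0 have K: "closed_in {u \<in> ?U. \<phi> u \<in> {\<alpha>, \<beta>}} K" unfolding pair by simp
  have eq: "\<psi>' u = (if u \<in> K then transpose \<alpha> \<beta> (\<phi> u) else \<phi> u)" if "u \<in> ?U" for u
    using eq0 that agree[OF that] unfolding tr by simp
  have KU: "K \<subseteq> ?U" "\<And>u. u \<in> K \<Longrightarrow> \<phi> u \<in> {\<alpha>, \<beta>}" using K unfolding closed_in_def by auto
  have Kcl: "t \<in> K" if "s \<in> K" "t \<in> ?U" "\<phi> t \<in> {\<alpha>, \<beta>}" "E s t" for s t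
    using K that unfolding closed_in_def by blast
  have KL: "transpose \<alpha> \<beta> (\<phi> u) \<in> L u" if "u \<in> K" for u
    using eq[of u] that KU(1) col_in[OF \<psi>', of u] by auto
  \<comment> \<open>Once \<open>v\<close> has a color outside the pair, or no neighbor in
    \<open>K\<close>, the swap on \<open>K\<close> is also a swap in \<open>W\<close>.\<close>
  have direct: ?thesis if \<rho>: "\<rho> \<in> col W L" "\<And>u. u \<in> ?U \<Longrightarrow> \<rho> u = \<phi> u" "eqv W L \<phi> \<rho>"
    and free: "\<rho> v \<in> {\<alpha>, \<beta>} \<Longrightarrow> \<forall>u \<in> K. \<not> E u v" for \<rho>
  proof -
    define \<psi> where "\<psi> u = (if u \<in> K then transpose \<alpha> \<beta> (\<rho> u) else \<rho> u)" for u
    have \<rho>K: "\<rho> u = \<phi> u" if "u \<in> K" for u using \<rho>(2) KU(1) that by blast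
    have "(\<rho>, \<psi>) \<in> step W L"
    proof (rule stepI[OF \<rho>(1)])
      have "t \<in> K" if "s \<in> K" "t \<in> W" "\<rho> t \<in> {\<alpha>, \<beta>}" "E s t" for s t
        using Kcl[OF that(1) _ _ that(4)] that \<rho>(2)[of t] free by (cases "t = v") auto
      moreover have "\<rho> u \<in> {\<alpha>, \<beta>}" "u \<in> W" if "u \<in> K" for u
        using that KU \<rho>K[OF that] by auto
      ultimately show "closed_in {u \<in> W. \<rho> u \<in> {\<alpha>, \<beta>}} K" unfolding closed_in_def by blast
    qed (use KL \<rho>K in \<open>auto simp: \<psi>_def\<close>)
    moreover from this have "\<psi> \<in> col W L" by (rule step_col)
    moreover have "\<psi> u = \<psi>' u" if "u \<in> ?U" for u using eq[OF that] \<rho>(2)[OF that] by (simp add: \<psi>_def)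
    ultimately show ?thesis using \<rho>(3) by (meson rtrancl.rtrancl_into_rtrancl)
  qed
  show ?thesis
  proof (cases "\<phi> v \<in> {\<alpha>, \<beta>} \<longrightarrow> (\<forall>u \<in> K. \<not> E u v)")
    case True
    then show ?thesis using direct[OF \<phi>] by blast
  next
    case False
    then obtain w where w: "w \<in> K" "E w v" and va: "\<phi> v = \<alpha>" using v\<alpha> by blast
    have wU: "w \<in> ?U" using w KU by blast
    have wb: "\<phi> w = \<beta>" using KU(2)[OF w(1)] col_ne[OF \<phi> _ vW w(2)] wU va by auto
    have "\<alpha> \<noteq> \<beta>" using col_ne[OF \<phi> _ vW w(2)] wU va wb by auto
    show ?thesis
    proof (cases "\<beta> \<in> L v \<and> (\<forall>u \<in> ?U. E v u \<longrightarrow> \<phi> u = \<beta> \<longrightarrow> u \<in> K)")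
      case True
      define \<psi> where "\<psi> u = (if u \<in> insert v K then transpose \<alpha> \<beta> (\<phi> u) else \<phi> u)" for u
      have "(\<phi>, \<psi>) \<in> step W L"
      proof (rule stepI[OF \<phi>])
        have "t \<in> insert v K" if "s \<in> insert v K" "t \<in> W" "\<phi> t \<in> {\<alpha>, \<beta>}" "E s t" for s t
        proof (cases "s = v")
          case s: True
          have "\<phi> t \<noteq> \<alpha>" using col_ne[OF \<phi> vW that(2)] s that(4) va by metis
          then show ?thesis using True s that by blast
        next
          case False
          then show ?thesis using Kcl[of s t] that by blast
        qed
        moreover have "u \<in> W \<and> \<phi> u \<in> {\<alpha>, \<beta>}" if "u \<in> insert v K" for u
          using that va KU vW by auto
        ultimately show "closed_in {u \<in> W. \<phi> u \<in> {\<alpha>, \<beta>}} (insert v K)"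
          unfolding closed_in_def by blast
      qed (use KL True va in \<open>auto simp: \<psi>_def\<close>)
      moreover from this have "\<psi> \<in> col W L" by (rule step_col)
      moreover have "\<psi> u = \<psi>' u" if "u \<in> ?U" for u using eq[OF that] that by (simp add: \<psi>_def)
      ultimately show ?thesis by (meson r_into_rtrancl)
    next
      case False
      let ?N = "nbrs W v"
      have wN: "w \<in> ?N" using w sym wU by (auto simp: nbrs_def)
      \<comment> \<open>The color \<beta> of \<open>w\<close> is missing from \<open>L v\<close> or
        recurs at a neighbor outside \<open>K\<close>. So the neighbors exclude fewer than
        \<open>card ?N\<close> colors of \<open>L v\<close>, and a color other than \<alpha> remains
        for \<open>v\<close>.\<close>
      have "L v \<inter> \<phi> ` ?N \<subseteq> \<phi> ` (?N - {w})"
      proof (cases "\<beta> \<in> L v")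
        case True
        then obtain w' where "w' \<in> ?U" "E v w'" "\<phi> w' = \<beta>" "w' \<notin> K" using False by blast
        then have "\<beta> \<in> \<phi> ` (?N - {w})" using w(1) by (force simp: nbrs_def)
        then show ?thesis using wb by blast
      next
        case False
        then show ?thesis using wb by auto
      qed
      then have "card (L v \<inter> \<phi> ` ?N) \<le> card (?N - {w})"
        using fin by (meson card_image_le card_mono finite_Diff finite_imageI finite_nbrs le_trans)
      also have "\<dots> < card ?N" using wN fin by (intro card_Diff1_less) auto
      finally have lt: "card (insert \<alpha> (L v \<inter> \<phi> ` ?N)) < card (L v)"
        using deg fin by (simp add: card_insert_if)
      have "\<not> L v \<subseteq> insert \<alpha> (L v \<inter> \<phi> ` ?N)"
        using lt fin by (metis card_mono finite.insertI finite_Int finite_imageI finite_nbrs not_le)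
      then obtain \<gamma> where \<gamma>: "\<gamma> \<in> L v" "\<gamma> \<noteq> \<alpha>" "\<gamma> \<notin> \<phi> ` ?N" by blast
      have "\<gamma> \<noteq> \<beta>" using \<gamma>(3) wb wN by blast
      have st: "(\<phi>, \<phi>(v := \<gamma>)) \<in> step W L"
        using \<gamma> by (intro recolor_step[OF \<phi> vW]) (auto simp: nbrs_def)
      then show ?thesis
        using direct[OF step_col[OF st] _ r_into_rtrancl[OF st]] \<gamma>(2) \<open>\<gamma> \<noteq> \<beta>\<close> by simp
    qed
  qed
qed

text \<open>Induction on \<open>W\<close>, deleting a vertex with more colors than neighbors:
  colorings extend to it greedily, and equivalences extend to it step by step.\<close>

lemma degenerate_swappable:
  assumes "finite W"
    and "\<And>S. S \<subseteq> W \<Longrightarrow> S \<noteq> {} \<Longrightarrow> \<exists>v \<in> S. card (nbrs S v) < card (L v)"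
  shows "col W L \<noteq> {} \<and> (\<forall>\<phi> \<in> col W L. \<forall>\<psi> \<in> col W L. eqv W L \<phi> \<psi>)"
  using assms
proof (induction W rule: finite_psubset_induct)
  case (psubset W)
  show ?case
  proof (cases "W = {}")
    case True
    then show ?thesis using eqv_agree[of _ W L] by (auto simp: col_def)
  next
    case False
    then obtain v where v: "v \<in> W" "card (nbrs W v) < card (L v)" using psubset.prems by blast
    let ?U = "W - {v}"
    have IH: "col ?U L \<noteq> {}" "\<And>\<phi> \<psi>. \<phi> \<in> col ?U L \<Longrightarrow> \<psi> \<in> col ?U L \<Longrightarrow> eqv ?U L \<phi> \<psi>"
      using psubset.IH[of ?U] psubset.prems v(1) by blast+
    have ex: "col W L \<noteq> {}"
    proof -
      obtain \<phi> where \<phi>: "\<phi> \<in> col ?U L" using IH(1) by blast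
      have "card (\<phi> ` nbrs W v) < card (L v)"
        using v(2) psubset.hyps by (meson card_image_le finite_nbrs le_less_trans)
      then have "\<not> L v \<subseteq> \<phi> ` nbrs W v"
        using psubset.hyps by (meson card_mono finite_imageI finite_nbrs not_le)
      then obtain \<gamma> where "\<gamma> \<in> L v" "\<gamma> \<notin> \<phi> ` nbrs W v" by blast
      then have "\<phi>(v := \<gamma>) \<in> col W L"
        using \<phi> sym irrefl unfolding col_def nbrs_def by auto
      then show ?thesis by blast
    qed
    have "eqv W L \<phi> \<psi>" if \<phi>: "\<phi> \<in> col W L" and \<psi>: "\<psi> \<in> col W L" for \<phi> \<psi>
    proof -
      have "eqv ?U L \<phi> \<psi>" using IH(2) \<phi> \<psi> col_subset[of _ W L ?U] by blast
      then have "\<exists>\<chi>. \<chi> \<in> col W L \<and> (\<forall>u \<in> ?U. \<chi> u = \<psi> u) \<and> eqv W L \<phi> \<chi>"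
      proof (induction rule: rtrancl_induct)
        case base
        then show ?case using \<phi> by blast
      next
        case (step \<psi>1 \<psi>2)
        then obtain \<chi> where \<chi>: "\<chi> \<in> col W L" "\<forall>u \<in> ?U. \<chi> u = \<psi>1 u" "eqv W L \<phi> \<chi>" by blast
        from step_extend_vertex[OF psubset.hyps v step.hyps(2) \<chi>(1)] \<chi>(2,3)
        show ?case by (meson rtrancl_trans)
      qed
      then obtain \<chi> where \<chi>: "\<chi> \<in> col W L" "\<forall>u \<in> ?U. \<chi> u = \<psi> u" "eqv W L \<phi> \<chi>" by blast
      \<comment> \<open>Only the color at \<open>v\<close> may still be wrong; the neighbors of
        \<open>v\<close> are colored as in \<psi>, so they leave \<open>\<psi> v\<close>
        free.\<close>
      have "(\<chi>, \<chi>(v := \<psi> v)) \<in> step W L"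
      proof (rule recolor_step[OF \<chi>(1) v(1) col_in[OF \<psi> v(1)]])
        show "\<chi> u \<noteq> \<psi> v" if "u \<in> W" "E v u" for u
          using col_ne[OF \<psi> v(1) that] \<chi>(2) that irrefl by (metis DiffI singletonD)
      qed
      moreover have "eqv W L \<psi> (\<chi>(v := \<psi> v))" by (rule eqv_agree[OF \<psi>]) (use \<chi>(2) in auto)
      ultimately show ?thesis using \<chi>(3) eqv_sym by (meson rtrancl.rtrancl_into_rtrancl rtrancl_trans)
    qed
    then show ?thesis using ex by blast
  qed
qed

section \<open>Extending a partial coloring\<close>

text \<open>A vertex of \<open>K\<close> has one color of the pair before the swap and the other
  after it. Both lie in its reduced list, so no fixed neighbor has either color and \<open>K\<close>
  remains closed in \<open>W\<close>.\<close>

lemma step_lift: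
  assumes R: "R \<subseteq> W" and \<rho>: "\<rho> \<in> col R L"
    and st: "(\<phi>, \<psi>) \<in> step (W - R) (\<lambda>w. L w - \<rho> ` nbrs R w)"
  shows "(\<lambda>v. if v \<in> R then \<rho> v else \<phi> v, \<lambda>v. if v \<in> R then \<rho> v else \<psi> v) \<in> step W L"
proof -
  let ?L = "\<lambda>w. L w - \<rho> ` nbrs R w" and ?o = "\<lambda>\<phi> v. if v \<in> R then \<rho> v else \<phi> v"
  obtain \<alpha> \<beta> K where \<phi>: "\<phi> \<in> col (W - R) ?L" and \<psi>: "\<psi> \<in> col (W - R) ?L"
    and K: "closed_in {v \<in> W - R. \<phi> v \<in> {\<alpha>, \<beta>}} K"
    and eq: "\<forall>v \<in> W - R. \<psi> v = (if v \<in> K then transpose \<alpha> \<beta> (\<phi> v) else \<phi> v)"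
    using st unfolding step_def by blast
  have oc: "?o \<phi> \<in> col W L" if "\<phi> \<in> col (W - R) ?L" for \<phi>
  proof -
    have ne: "\<phi> u \<noteq> \<rho> v" if "u \<in> W - R" "v \<in> R" "E u v" for u v
      using col_in[OF \<open>\<phi> \<in> col (W - R) ?L\<close> that(1)] that by (auto simp: nbrs_def)
    have "?o \<phi> u \<noteq> ?o \<phi> v" if "u \<in> W" "v \<in> W" "E u v" for u v
    proof -
      consider "u \<in> R" "v \<in> R" | "u \<in> R" "v \<notin> R" | "u \<notin> R" "v \<in> R" | "u \<notin> R" "v \<notin> R" by blast
      then show ?thesis
        by cases (use that ne[of u v] ne[of v u] sym[of u v] col_ne[OF \<rho>, of u v]
            col_ne[OF \<open>\<phi> \<in> col (W - R) ?L\<close>, of u v] in auto)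
    qed
    moreover have "?o \<phi> v \<in> L v" if "v \<in> W" for v
      using that col_in[OF \<rho>, of v] col_in[OF \<open>\<phi> \<in> col (W - R) ?L\<close>, of v] by auto
    ultimately show ?thesis unfolding col_def by blast
  qed
  have KW: "K \<subseteq> W - R" "\<And>v. v \<in> K \<Longrightarrow> \<phi> v \<in> {\<alpha>, \<beta>}" using K unfolding closed_in_def by auto
  have free: "\<rho> r \<notin> {\<alpha>, \<beta>}" if "s \<in> K" "r \<in> R" "E s r" for s r
  proof -
    have s: "s \<in> W - R" using that KW by blast
    have "\<rho> r \<in> \<rho> ` nbrs R s" using that by (auto simp: nbrs_def)
    then have "\<rho> r \<noteq> \<phi> s" "\<rho> r \<noteq> \<psi> s" using col_in[OF \<phi> s] col_in[OF \<psi> s] by auto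
    moreover have "\<psi> s = transpose \<alpha> \<beta> (\<phi> s)" using eq s that(1) by simp
    ultimately show ?thesis using KW(2)[OF that(1)] by auto
  qed
  show ?thesis
  proof (rule stepI[OF oc[OF \<phi>]])
    show "closed_in {v \<in> W. ?o \<phi> v \<in> {\<alpha>, \<beta>}} K"
      using K free R unfolding closed_in_def by (auto split: if_splits)
    show "transpose \<alpha> \<beta> (?o \<phi> v) \<in> L v" if "v \<in> K" for v
      using that KW(1) eq col_in[OF \<psi>, of v] by auto
    show "?o \<psi> v = (if v \<in> K then transpose \<alpha> \<beta> (?o \<phi> v) else ?o \<phi> v)" if "v \<in> W" for v
      using that eq KW(1) by auto
  qed
qed

text \<open>If \<open>v\<close> has at least as many colors as neighbors in \<open>W\<close>, each
  alternative leaves it more colors than free neighbors when the colors of its neighbors in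
  \<open>R\<close> are deleted: a surplus from the start, a fixed color that deletes nothing, or two
  fixed neighbors that delete only one color.\<close>

definition slack :: "'a set \<Rightarrow> ('a \<Rightarrow> 'c set) \<Rightarrow> 'a set \<Rightarrow> ('a \<Rightarrow> 'c) \<Rightarrow> 'a \<Rightarrow> bool" where
  "slack W L R \<rho> v \<longleftrightarrow> card (nbrs W v) < card (L v) \<or> (\<exists>r \<in> R. E v r \<and> \<rho> r \<notin> L v) \<or>
     (\<exists>r \<in> R. \<exists>r' \<in> R. r \<noteq> r' \<and> E v r \<and> E v r' \<and> \<rho> r = \<rho> r')"

section \<open>Precolorings with slack in every component of the rest\<close>

context
  fixes W R :: "'a set" and L :: "'a \<Rightarrow> 'c set" and \<rho> :: "'a \<Rightarrow> 'c"
  assumes fin: "finite W" and R: "R \<subseteq> W" and \<rho>: "\<rho> \<in> col R L"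
    and deg: "\<And>v. v \<in> W \<Longrightarrow> card (nbrs W v) \<le> card (L v)"
    and slack: "\<And>S. S \<noteq> {} \<Longrightarrow> closed_in (W - R) S \<Longrightarrow> \<exists>v \<in> S. slack W L R \<rho> v"
begin

private abbreviation "L' \<equiv> \<lambda>w. L w - \<rho> ` nbrs R w"

private lemma card_nbrs_split: "card (nbrs W v) = card (nbrs (W - R) v) + card (nbrs R v)"
proof -
  have "nbrs W v = nbrs (W - R) v \<union> nbrs R v" "nbrs (W - R) v \<inter> nbrs R v = {}"
    using R by (auto simp: nbrs_def)
  then show ?thesis using fin R by (metis card_Un_disjoint finite_Diff finite_nbrs finite_subset)
qed

private lemma card_L'_ge: "v \<in> W \<Longrightarrow> card (nbrs (W - R) v) \<le> card (L' v)"
proof -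
  assume v: "v \<in> W"
  have f: "finite (nbrs R v)" using fin R finite_subset finite_nbrs by blast
  have "card (L v) - card (\<rho> ` nbrs R v) \<le> card (L' v)"
    using f by (simp add: diff_card_le_card_Diff)
  moreover have "card (\<rho> ` nbrs R v) \<le> card (nbrs R v)" using f by (rule card_image_le)
  ultimately show ?thesis using deg[OF v] card_nbrs_split[of v] by linarith
qed

private lemma card_L'_gt:
  assumes v: "v \<in> W" and s: "slack W L R \<rho> v"
  shows "card (nbrs (W - R) v) < card (L' v)"
proof -
  have f: "finite (nbrs R v)" using fin R finite_subset finite_nbrs by blast
  have eq: "L' v = L v - (L v \<inter> \<rho> ` nbrs R v)" by blast
  have ge: "card (L v) - card (L v \<inter> \<rho> ` nbrs R v) \<le> card (L' v)"
    unfolding eq using f by (simp add: diff_card_le_card_Diff)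
  have le: "card (L v \<inter> \<rho> ` nbrs R v) \<le> card (nbrs R v)"
    using f by (meson Int_lower2 card_image_le card_mono finite_imageI le_trans)
  \<comment> \<open>A fixed neighbor \<open>r\<close> is wasted if the others already account for
    every deleted color of \<open>L v\<close>.\<close>
  have lt: "card (L v \<inter> \<rho> ` nbrs R v) < card (nbrs R v)"
    if r: "r \<in> nbrs R v" "L v \<inter> \<rho> ` nbrs R v \<subseteq> \<rho> ` (nbrs R v - {r})" for r
  proof -
    have "card (L v \<inter> \<rho> ` nbrs R v) \<le> card (nbrs R v - {r})"
      using r(2) f by (meson card_image_le card_mono finite_Diff finite_imageI le_trans)
    also have "\<dots> < card (nbrs R v)" using r(1) f by (rule card_Diff1_less[rotated])
    finally show ?thesis .
  qed
  consider "card (nbrs W v) < card (L v)"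
    | r where "r \<in> R" "E v r" "\<rho> r \<notin> L v"
    | r r' where "r \<in> R" "r' \<in> R" "r \<noteq> r'" "E v r" "E v r'" "\<rho> r = \<rho> r'"
    using s unfolding slack_def by blast
  then show ?thesis
  proof cases
    case 1
    then show ?thesis using ge le card_nbrs_split[of v] by linarith
  next
    case 2
    then have "card (L v \<inter> \<rho> ` nbrs R v) < card (nbrs R v)" by (intro lt[of r]) (auto simp: nbrs_def)
    then show ?thesis using ge deg[OF v] card_nbrs_split[of v] by linarith
  next
    case 3
    then have "card (L v \<inter> \<rho> ` nbrs R v) < card (nbrs R v)"
      by (intro lt[of r]) (auto simp: nbrs_def)
    then show ?thesis using ge deg[OF v] card_nbrs_split[of v] by linarith
  qed
qed

text \<open>Degeneracy is checked set by set: a closed \<open>S\<close> contains a vertex with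
  slack, and any other \<open>S\<close> contains a vertex that loses a neighbor on passing from
  \<open>W - R\<close> to \<open>S\<close>.\<close>

private lemma swappable_rest:
  "col (W - R) L' \<noteq> {} \<and> (\<forall>\<phi> \<in> col (W - R) L'. \<forall>\<psi> \<in> col (W - R) L'. eqv (W - R) L' \<phi> \<psi>)"
proof (rule degenerate_swappable)
  show "finite (W - R)" using fin by blast
  fix S assume S: "S \<subseteq> W - R" "S \<noteq> {}"
  show "\<exists>v \<in> S. card (nbrs S v) < card (L' v)"
  proof (cases "closed_in (W - R) S")
    case True
    then obtain v where v: "v \<in> S" "slack W L R \<rho> v" using slack S by blast
    have "card (nbrs S v) \<le> card (nbrs (W - R) v)"
      using S(1) fin by (intro card_mono) (auto simp: nbrs_def)
    then show ?thesis using card_L'_gt[of v] v S(1) by force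
  next
    case False
    then obtain v t where v: "v \<in> S" "t \<in> W - R" "E v t" "t \<notin> S"
      using S(1) unfolding closed_in_def by blast
    have "nbrs S v \<subset> nbrs (W - R) v" using v S(1) by (auto simp: nbrs_def)
    then have "card (nbrs S v) < card (nbrs (W - R) v)" using fin by (simp add: psubset_card_mono)
    then show ?thesis using card_L'_ge[of v] v S(1) by force
  qed
qed

lemma extend_coloring: "\<exists>\<psi> \<in> col W L. \<forall>r \<in> R. \<psi> r = \<rho> r"
proof -
  obtain \<phi> where "\<phi> \<in> col (W - R) L'" using swappable_rest by blast
  \<comment> \<open>Lifting the trivial step shows that \<rho> and \<phi> glue to a coloring of
    \<open>W\<close>.\<close>
  then have "(\<phi>, \<phi>) \<in> step (W - R) L'" using stepI[of \<phi> "W - R" L' _ _ "{}" \<phi>] by (auto simp: closed_in_def)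
  from step_lift[OF R \<rho> this] show ?thesis
    by (intro bexI[of _ "\<lambda>v. if v \<in> R then \<rho> v else \<phi> v"]) (auto simp: step_def)
qed

lemma extensions_equivalent:
  assumes \<phi>: "\<phi> \<in> col W L" "\<And>r. r \<in> R \<Longrightarrow> \<phi> r = \<rho> r"
    and \<psi>: "\<psi> \<in> col W L" "\<And>r. r \<in> R \<Longrightarrow> \<psi> r = \<rho> r"
  shows "eqv W L \<phi> \<psi>"
proof -
  let ?o = "\<lambda>\<phi> v. if v \<in> R then \<rho> v else \<phi> v"
  have restr: "\<chi> \<in> col (W - R) L'" if "\<chi> \<in> col W L" "\<And>r. r \<in> R \<Longrightarrow> \<chi> r = \<rho> r" for \<chi>
  proof -
    have "\<chi> v \<notin> \<rho> ` nbrs R v" if "v \<in> W" for v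
      using col_ne[OF \<open>\<chi> \<in> col W L\<close> that] R \<open>\<And>r. r \<in> R \<Longrightarrow> \<chi> r = \<rho> r\<close>
      by (fastforce simp: nbrs_def)
    then show ?thesis using that(1) by (auto simp: col_def)
  qed
  have "eqv (W - R) L' \<phi> \<psi>" using swappable_rest restr \<phi> \<psi> by blast
  then have "eqv W L (?o \<phi>) (?o \<psi>)"
  proof (induction rule: rtrancl_induct)
    case base
    then show ?case by blast
  next
    case (step \<psi>1 \<psi>2)
    then show ?case using step_lift[OF R \<rho> step.hyps(2)] by (meson rtrancl.rtrancl_into_rtrancl)
  qed
  moreover have "?o \<phi> = \<phi>" "?o \<psi> = \<psi>" using \<phi>(2) \<psi>(2) by auto
  ultimately show ?thesis by simp
qed

end

end

section \<open>Leaves of a connected regular graph\<close>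

locale regular_lists = sym_irrefl E for E :: "'a \<Rightarrow> 'a \<Rightarrow> bool" +
  fixes V :: "'a set" and L :: "'a \<Rightarrow> 'c set" and k :: nat
  assumes finite_V: "finite V"
    and adj_V: "E u v \<Longrightarrow> u \<in> V"
    and connected_V: "connected_set V"
    and card_nbrs: "v \<in> V \<Longrightarrow> card (nbrs V v) = k"
    and finite_L: "v \<in> V \<Longrightarrow> finite (L v)"
    and card_L: "v \<in> V \<Longrightarrow> card (L v) = k"
begin

text \<open>\<open>insert x C\<close> is a leaf block with cut vertex \<open>x\<close>, or a union
  of several such blocks at \<open>x\<close>. The definition records only that \<open>x\<close>
  separates \<open>C\<close> from a nonempty rest and that no vertex of \<open>C\<close> is a cut
  vertex.\<close>

definition leaf :: "'a \<Rightarrow> 'a set \<Rightarrow> bool" where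
  "leaf x C \<longleftrightarrow> x \<in> V \<and> C \<noteq> {} \<and> closed_in (V - {x}) C \<and> insert x C \<noteq> V \<and>
     (\<forall>y \<in> C. connected_set (V - {y}))"

lemma list_diff_nonempty:
  assumes "u \<in> V" "v \<in> V" "L u \<noteq> L v"
  obtains \<gamma> where "\<gamma> \<in> L u" "\<gamma> \<notin> L v"
  using assms finite_L card_L by (metis card_subset_eq subsetI)

lemma exists_extension:
  assumes "R \<subseteq> V" "\<rho> \<in> col R L"
    and "\<And>S. S \<noteq> {} \<Longrightarrow> closed_in (V - R) S \<Longrightarrow> \<exists>v \<in> S. slack V L R \<rho> v"
  shows "\<exists>\<psi>. \<psi> \<in> col V L \<and> (\<forall>r \<in> R. \<psi> r = \<rho> r)"
  using extend_coloring[OF finite_V assms(1,2) _ assms(3)] card_nbrs card_L by auto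

lemma equivalent_if_agree:
  assumes "R \<subseteq> V" "\<phi> \<in> col V L" "\<psi> \<in> col V L" "\<And>r. r \<in> R \<Longrightarrow> \<psi> r = \<phi> r"
    and "\<And>S. S \<noteq> {} \<Longrightarrow> closed_in (V - R) S \<Longrightarrow> \<exists>v \<in> S. slack V L R \<phi> v"
  shows "eqv V L \<phi> \<psi>"
  using extensions_equivalent[OF finite_V assms(1) col_subset[OF assms(2,1)] _ assms(5)]
    card_nbrs card_L assms(2-4) by auto

section \<open>How a leaf is attached to the rest of the graph\<close>

lemma leaf_subset: "leaf x C \<Longrightarrow> C \<subseteq> V - {x}"
  by (simp add: leaf_def closed_in_def)

lemma leaf_adj: "leaf x C \<Longrightarrow> a \<in> C \<Longrightarrow> E a b \<Longrightarrow> b \<in> insert x C"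
  using adj_V sym unfolding leaf_def closed_in_def by blast

text \<open>Edges leave \<open>U\<close> only at \<open>x\<close>, so a closed set avoiding
  \<open>x\<close> would be closed in the connected set \<open>V - Z\<close> and hence equal to it.
  Thus slack at \<open>x\<close> serves every component of \<open>U - Z\<close>.\<close>

lemma leaf_root_mem:
  assumes l: "leaf x C" and U: "U = V - C \<or> U = insert x C"
    and Z: "connected_set (V - Z)" "x \<notin> Z"
    and S: "S \<noteq> {}" "closed_in (U - Z) S"
  shows "x \<in> S"
proof (rule ccontr)
  assume x: "x \<notin> S"
  have UV: "U \<subseteq> V" using U leaf_subset[OF l] l by (auto simp: leaf_def)
  have "t \<in> S" if st: "s \<in> S" "t \<in> V - Z" "E s t" for s t
  proof -
    have s: "s \<in> U" "s \<noteq> x" using S x st unfolding closed_in_def by auto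
    have "t \<in> U" using U s leaf_adj[OF l, of s t] leaf_adj[OF l, of t s] st sym[of s t] by blast
    then show ?thesis using S st unfolding closed_in_def by blast
  qed
  then have "closed_in (V - Z) S" using S UV unfolding closed_in_def by blast
  then have "S = V - Z" using connected_setD Z S by blast
  then show False using x Z l by (auto simp: leaf_def)
qed

lemma leaf_root_nbr_in:
  assumes l: "leaf x C" obtains a where "a \<in> C" "E x a"
proof (rule ccontr)
  assume "\<not> thesis"
  then have "closed_in V C" using l that sym unfolding leaf_def closed_in_def by blast
  then have "C = V" using l connected_setD[OF connected_V] by (auto simp: leaf_def)
  then show False using leaf_subset[OF l] l by (auto simp: leaf_def)
qed

lemma leaf_root_nbr_out:
  assumes l: "leaf x C" obtains a where "a \<in> V - insert x C" "E x a"
proof (rule ccontr)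
  assume "\<not> thesis"
  then have "closed_in V (V - insert x C)"
    using leaf_adj[OF l] that sym unfolding closed_in_def by blast
  moreover have "V - insert x C \<noteq> {}" using leaf_subset[OF l] l by (auto simp: leaf_def)
  ultimately have "V - insert x C = V" by (intro connected_setD[OF connected_V])
  then show False using l by (auto simp: leaf_def)
qed

text \<open>The root has a neighbor on the other side, so within \<open>U\<close> it has fewer than
  \<open>k\<close> neighbors and slack with nothing fixed.\<close>

lemma leaf_side_swappable:
  assumes l: "leaf x C" and U: "U = V - C \<or> U = insert x C"
  shows "col U L \<noteq> {}" "\<phi> \<in> col U L \<Longrightarrow> \<psi> \<in> col U L \<Longrightarrow> eqv U L \<phi> \<psi>"
proof -
  have xV: "x \<in> V" and UV: "U \<subseteq> V" using U leaf_subset[OF l] l by (auto simp: leaf_def)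
  have fin: "finite U" using UV finite_V finite_subset by blast
  have deg: "card (nbrs U v) \<le> card (L v)" if "v \<in> U" for v
  proof -
    have "card (nbrs U v) \<le> card (nbrs V v)"
      using UV finite_V by (intro card_mono) (auto simp: nbrs_def)
    then show ?thesis using card_nbrs card_L that UV by auto
  qed
  have "\<exists>a \<in> V - U. E x a"
  proof (rule leaf_root_nbr_in[OF l], rule leaf_root_nbr_out[OF l])
    fix a b assume "a \<in> C" "E x a" "b \<in> V - insert x C" "E x b"
    then show ?thesis using U leaf_subset[OF l] by blast
  qed
  then obtain a where "a \<in> V - U" "E x a" by blast
  then have "nbrs U x \<subset> nbrs V x" using UV by (auto simp: nbrs_def)
  then have "card (nbrs U x) < card (L x)"
    using finite_V card_nbrs[OF xV] card_L[OF xV] by (metis finite_nbrs psubset_card_mono)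
  then have "slack U L {} \<rho> x" for \<rho> by (simp add: slack_def)
  then have sl: "\<exists>v \<in> S. slack U L {} \<rho> v" if "S \<noteq> {}" "closed_in (U - {}) S" for S \<rho>
    using leaf_root_mem[OF l U, of "{}" S] that connected_V by auto
  have e: "\<rho> \<in> col {} L" for \<rho> by (simp add: col_def)
  show "col U L \<noteq> {}" using extend_coloring[OF fin _ e deg sl] by auto
  show "\<phi> \<in> col U L \<Longrightarrow> \<psi> \<in> col U L \<Longrightarrow> eqv U L \<phi> \<psi>"
    using extensions_equivalent[OF fin _ e deg sl] by auto
qed

text \<open>A pair of a root and a separated set inside \<open>A\<close> is chosen with the set as
  small as possible; a cut vertex inside that set would separate a smaller one.\<close>

lemma leaf_exists:
  assumes x0: "x0 \<in> V" and A: "A \<noteq> {}" "closed_in (V - {x0}) A" "insert x0 A \<noteq> V"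
  obtains x C where "leaf x C" "C \<subseteq> A" "x \<in> insert x0 A"
proof -
  define P where "P = (\<lambda>(x, C). C \<noteq> {} \<and> C \<subseteq> A \<and> x \<in> insert x0 A \<and> closed_in (V - {x}) C)"
  have "P (x0, A)" using A by (auto simp: P_def)
  then obtain p where p: "P p" "\<And>q. P q \<Longrightarrow> card (snd p) \<le> card (snd q)"
    using ex_has_least_nat[of P _ "\<lambda>q. card (snd q)"] by blast
  obtain x C where xC: "p = (x, C)" by (cases p)
  have C: "C \<noteq> {}" "C \<subseteq> A" "x \<in> insert x0 A" "closed_in (V - {x}) C"
    using p(1) by (auto simp: P_def xC)
  have AV: "A \<subseteq> V - {x0}" and CV: "C \<subseteq> V - {x}" using A C by (auto simp: closed_in_def)
  have xV: "x \<in> V" using C(3) AV x0 by blast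
  have conn: "connected_set (V - {y})" if y: "y \<in> C" for y
    unfolding connected_set_def
  proof (intro allI impI, rule ccontr)
    fix S assume S: "S \<noteq> {}" "closed_in (V - {y}) S" "S \<noteq> V - {y}"
    \<comment> \<open>Of the two sides of the cut at \<open>y\<close>, this is the one without
      \<open>x\<close>.\<close>
    define T where "T = (if x \<in> S then V - {y} - S else S)"
    have SV: "S \<subseteq> V - {y}" using S by (simp add: closed_in_def)
    then have T: "T \<noteq> {}" "closed_in (V - {y}) T" "x \<notin> T"
      using S closed_in_Diff[OF S(2)] by (auto simp: T_def)
    \<comment> \<open>No edge leads from \<open>V - insert x C\<close> into \<open>C\<close>, and
      \<open>T\<close> avoids \<open>x\<close>; so \<open>T - C\<close> is closed in the connected
      graph and misses \<open>x\<close>, hence is empty.\<close>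
    have "closed_in V (T - C)"
      unfolding closed_in_def
    proof (intro conjI ballI impI)
      show "T - C \<subseteq> V" using T by (auto simp: closed_in_def)
      fix s t assume st: "s \<in> T - C" "t \<in> V" "E s t"
      have "s \<in> V - {x}" using T st by (auto simp: closed_in_def)
      then have "t \<notin> C" using C(4) st sym[OF st(3)] by (auto simp: closed_in_def)
      moreover from this have "t \<in> T" using T(2) st y by (auto simp: closed_in_def)
      ultimately show "t \<in> T - C" by blast
    qed
    then have "T - C = {}" using connected_setD[OF connected_V _ \<open>closed_in V (T - C)\<close>] T(3) xV by blast
    then have "T \<subset> C" using T(2) y by (auto simp: closed_in_def)
    moreover from this have "P (y, T)" using T C y by (auto simp: P_def)
    moreover have "finite C" using CV finite_V finite_subset by blast
    ultimately show False using p(2)[of "(y, T)"] psubset_card_mono[of C T] by (simp add: xC)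
  qed
  have "insert x C \<noteq> V"
  proof
    assume "insert x C = V"
    then have "V \<subseteq> insert x0 A" using C by blast
    then show False using A(3) AV x0 by blast
  qed
  then have "leaf x C" using C xV conn by (auto simp: leaf_def)
  then show thesis using that C by blast
qed

section \<open>A leaf with constant lists\<close>

context
  fixes x C
  assumes l: "leaf x C" and const: "\<And>v. v \<in> C \<Longrightarrow> L v = L x"
begin

private lemma CV: "C \<subseteq> V" "x \<notin> C" "x \<in> V"
  using leaf_subset[OF l] l by (auto simp: leaf_def)

private lemma step_inside:
  assumes "\<phi> \<in> col V L" "K \<subseteq> C" "closed_in {v \<in> insert x C. \<phi> v \<in> {\<alpha>, \<beta>}} K"
    "\<And>v. v \<in> K \<Longrightarrow> transpose \<alpha> \<beta> (\<phi> v) \<in> L x"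
  shows "(\<phi>, \<lambda>v. if v \<in> K then transpose \<alpha> \<beta> (\<phi> v) else \<phi> v) \<in> step V L"
proof (rule stepI[OF assms(1)])
  show "closed_in {v \<in> V. \<phi> v \<in> {\<alpha>, \<beta>}} K"
    using assms(2,3) CV leaf_adj[OF l] unfolding closed_in_def by blast
  show "transpose \<alpha> \<beta> (\<phi> v) \<in> L v" if "v \<in> K" for v using assms(2,4) const that by auto
qed simp

text \<open>Permutations are products of transpositions. As \<open>x\<close> has neither of the two
  transposed colors, exchanging them throughout \<open>C\<close> swaps whole Kempe components, and
  the constant lists make this valid.\<close>

private lemma permute_inside:
  assumes \<phi>: "\<phi> \<in> col V L" and \<sigma>: "\<sigma> permutes L x - {\<phi> x}"
  shows "eqv V L \<phi> (\<lambda>v. if v \<in> C then \<sigma> (\<phi> v) else \<phi> v)"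
proof -
  have "finite (L x - {\<phi> x})" using finite_L CV by blast
  with \<sigma> show ?thesis
  proof (induction rule: permutes_induct)
    case id
    show ?case by (rule eqv_agree[OF \<phi>]) simp
  next
    case (swap a b p)
    let ?\<chi> = "\<lambda>v. if v \<in> C then p (\<phi> v) else \<phi> v"
    let ?K = "{v \<in> C. ?\<chi> v \<in> {a, b}}"
    have "(?\<chi>, \<lambda>v. if v \<in> ?K then transpose a b (?\<chi> v) else ?\<chi> v) \<in> step V L"
    proof (rule step_inside)
      show "?\<chi> \<in> col V L" using eqv_col[OF swap.IH \<phi>] .
      show "closed_in {v \<in> insert x C. ?\<chi> v \<in> {a, b}} ?K"
        using CV swap.hyps unfolding closed_in_def by auto
    qed (use swap.hyps in auto)
    moreover have "(\<lambda>v. if v \<in> ?K then transpose a b (?\<chi> v) else ?\<chi> v) =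
        (\<lambda>v. if v \<in> C then (transpose a b \<circ> p) (\<phi> v) else \<phi> v)"
      by (auto simp: fun_eq_iff)
    ultimately show ?case using swap.IH by (metis (no_types, lifting) rtrancl.rtrancl_into_rtrancl)
  qed
qed

text \<open>
  A swap through \<open>x\<close> differs from the swap of all other components of the same two colors only by a
  permutation of the colors, and the latter leaves the rest of the graph alone.
\<close>

private lemma simulate_inside:
  assumes "eqv (insert x C) L \<phi>' \<psi>" and \<phi>: "\<phi> \<in> col V L"
    and agree: "\<And>v. v \<in> insert x C \<Longrightarrow> \<phi> v = \<phi>' v"
  shows "\<exists>\<sigma> \<chi>. \<sigma> permutes L x \<and> \<chi> \<in> col V L \<and> eqv V L \<phi> \<chi> \<and> (\<forall>v \<in> V - C. \<chi> v = \<phi> v) \<and>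
    (\<forall>v \<in> insert x C. \<chi> v = \<sigma> (\<psi> v))"
  using assms(1)
proof (induction rule: rtrancl_induct)
  case base
  show ?case using \<phi> agree permutes_id[of "L x"] by (intro exI[of _ id] exI[of _ \<phi>]) (simp add: id_def)
next
  case (step \<psi>1 \<psi>2)
  let ?B = "insert x C"
  obtain \<sigma> \<chi> where \<sigma>: "\<sigma> permutes L x" and \<chi>: "\<chi> \<in> col V L" "eqv V L \<phi> \<chi>"
    "\<forall>v \<in> V - C. \<chi> v = \<phi> v" "\<forall>v \<in> ?B. \<chi> v = \<sigma> (\<psi>1 v)" using step.IH by blast
  obtain \<alpha> \<beta> K where \<psi>1: "\<psi>1 \<in> col ?B L" and \<psi>2: "\<psi>2 \<in> col ?B L"
    and K: "closed_in {v \<in> ?B. \<psi>1 v \<in> {\<alpha>, \<beta>}} K"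
    and eq: "\<forall>v \<in> ?B. \<psi>2 v = (if v \<in> K then transpose \<alpha> \<beta> (\<psi>1 v) else \<psi>1 v)"
    using step.hyps(2) unfolding step_def by blast
  have inj: "inj \<sigma>" using \<sigma> by (rule permutes_inj)
  have tr: "transpose (\<sigma> \<alpha>) (\<sigma> \<beta>) (\<sigma> c) = \<sigma> (transpose \<alpha> \<beta> c)" for c
    using inj by (auto simp: transpose_def inj_eq)
  have col_iff: "\<chi> v \<in> {\<sigma> \<alpha>, \<sigma> \<beta>} \<longleftrightarrow> \<psi>1 v \<in> {\<alpha>, \<beta>}" if "v \<in> ?B" for v
    using \<chi>(4) that inj by (auto simp: inj_eq)
  then have sets: "{v \<in> ?B. \<chi> v \<in> {\<sigma> \<alpha>, \<sigma> \<beta>}} = {v \<in> ?B. \<psi>1 v \<in> {\<alpha>, \<beta>}}" by blast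
  have KB: "K \<subseteq> ?B" using K by (auto simp: closed_in_def)
  have LB: "L v = L x" if "v \<in> ?B" for v using that const by auto
  show ?case
  proof (cases "x \<in> K")
    case False
    let ?\<chi> = "\<lambda>v. if v \<in> K then transpose (\<sigma> \<alpha>) (\<sigma> \<beta>) (\<chi> v) else \<chi> v"
    have KC: "K \<subseteq> C" using KB False by blast
    have eq': "?\<chi> v = \<sigma> (\<psi>2 v)" if "v \<in> ?B" for v using that \<chi>(4) eq tr by auto
    have st: "(\<chi>, ?\<chi>) \<in> step V L"
    proof (rule step_inside[OF \<chi>(1) KC])
      show "closed_in {v \<in> ?B. \<chi> v \<in> {\<sigma> \<alpha>, \<sigma> \<beta>}} K" unfolding sets by (rule K)
      show "transpose (\<sigma> \<alpha>) (\<sigma> \<beta>) (\<chi> v) \<in> L x" if "v \<in> K" for v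
      proof -
        have "v \<in> ?B" using that KB by blast
        then have "\<sigma> (\<psi>2 v) \<in> L x" using permutes_in_image[OF \<sigma>, of "\<psi>2 v"] col_in[OF \<psi>2] LB by blast
        then show ?thesis using eq'[OF \<open>v \<in> ?B\<close>] that by simp
      qed
    qed
    have "\<forall>v \<in> V - C. ?\<chi> v = \<phi> v" using \<chi>(3) KC by auto
    then show ?thesis using \<sigma> st \<chi>(2) eq' step_col[OF st]
      by (intro exI[of _ \<sigma>] exI[of _ ?\<chi>]) (auto intro: rtrancl.rtrancl_into_rtrancl)
  next
    case True
    let ?K = "{v \<in> ?B. \<psi>1 v \<in> {\<alpha>, \<beta>}} - K"
    let ?\<chi> = "\<lambda>v. if v \<in> ?K then transpose (\<sigma> \<alpha>) (\<sigma> \<beta>) (\<chi> v) else \<chi> v"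
    let ?\<sigma> = "transpose (\<sigma> \<alpha>) (\<sigma> \<beta>) \<circ> \<sigma>"
    have "\<psi>1 x \<in> {\<alpha>, \<beta>}" using K True by (auto simp: closed_in_def)
    \<comment> \<open>The swap moves \<open>x\<close> itself, so both colors belong to the common
      list and their exchange permutes it.\<close>
    then have "\<alpha> \<in> L x" "\<beta> \<in> L x"
      using col_in[OF \<psi>1, of x] col_in[OF \<psi>2, of x] eq True by auto
    then have "\<sigma> \<alpha> \<in> L x" "\<sigma> \<beta> \<in> L x" using \<sigma> by (simp_all add: permutes_in_image)
    then have \<sigma>': "?\<sigma> permutes L x" using \<sigma> by (intro permutes_compose permutes_swap_id)
    have eq': "?\<chi> v = ?\<sigma> (\<psi>2 v)" if v: "v \<in> ?B" for v
    proof -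
      consider "v \<in> K" | "v \<in> ?K" | "\<psi>1 v \<notin> {\<alpha>, \<beta>}" "v \<notin> K" using v by blast
      then show ?thesis
      proof cases
        case 3
        then have "\<sigma> (\<psi>1 v) \<notin> {\<sigma> \<alpha>, \<sigma> \<beta>}" using inj by (auto simp: inj_eq)
        then show ?thesis using 3 v \<chi>(4) eq by auto
      qed (use v \<chi>(4) eq in \<open>auto simp: tr[symmetric]\<close>)
    qed
    have KC: "?K \<subseteq> C" using True by auto
    have st: "(\<chi>, ?\<chi>) \<in> step V L"
    proof (rule step_inside[OF \<chi>(1) KC])
      show "closed_in {v \<in> ?B. \<chi> v \<in> {\<sigma> \<alpha>, \<sigma> \<beta>}} ?K"
        unfolding sets by (rule closed_in_Diff[OF K])
      show "transpose (\<sigma> \<alpha>) (\<sigma> \<beta>) (\<chi> v) \<in> L x" if "v \<in> ?K" for v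
      proof -
        have v: "v \<in> ?B" using that by blast
        then have "?\<sigma> (\<psi>1 v) \<in> L x"
          using permutes_in_image[OF \<sigma>', of "\<psi>1 v"] col_in[OF \<psi>1] LB by blast
        then show ?thesis unfolding bspec[OF \<chi>(4) v] by simp
      qed
    qed
    have "\<forall>v \<in> V - C. ?\<chi> v = \<phi> v" using \<chi>(3) KC by auto
    then show ?thesis using \<sigma>' rtrancl.rtrancl_into_rtrancl[OF \<chi>(2) st] eq' step_col[OF st]
      by (intro exI[of _ ?\<sigma>] exI[of _ ?\<chi>] conjI ballI) blast+
  qed
qed

text \<open>Simulation on the leaf leads from \<phi> to \<psi> up to a permutation of
  \<open>L x\<close>. It fixes the color of \<open>x\<close>, since
  \<open>\<phi> x = \<psi> x\<close>, and can therefore be undone inside \<open>C\<close>.\<close>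

private lemma agree_outside_equivalent:
  assumes \<phi>: "\<phi> \<in> col V L" and \<psi>: "\<psi> \<in> col V L" and agree: "\<And>v. v \<in> V - C \<Longrightarrow> \<phi> v = \<psi> v"
  shows "eqv V L \<phi> \<psi>"
proof -
  have sub: "insert x C \<subseteq> V" using CV by blast
  have "eqv (insert x C) L \<phi> \<psi>"
    using leaf_side_swappable(2)[OF l] col_subset[OF \<phi> sub] col_subset[OF \<psi> sub] by blast
  then obtain \<sigma> \<chi> where \<sigma>: "\<sigma> permutes L x" and \<chi>: "\<chi> \<in> col V L" "eqv V L \<phi> \<chi>"
    "\<forall>v \<in> V - C. \<chi> v = \<phi> v" "\<forall>v \<in> insert x C. \<chi> v = \<sigma> (\<psi> v)"
    using simulate_inside[OF _ \<phi>] by blast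
  have "\<sigma> (\<psi> x) = \<psi> x" using \<chi> agree CV by force
  then have "\<sigma> permutes L x - {\<psi> x}" by (intro permutes_superset[OF \<sigma>]) auto
  then have *: "eqv V L \<psi> (\<lambda>v. if v \<in> C then \<sigma> (\<psi> v) else \<psi> v)" by (rule permute_inside[OF \<psi>])
  have "eqv V L (\<lambda>v. if v \<in> C then \<sigma> (\<psi> v) else \<psi> v) \<chi>"
    by (rule eqv_agree[OF eqv_col[OF * \<psi>]]) (use \<chi> agree in auto)
  then show ?thesis using eqv_trans[OF \<chi>(2) eqv_sym[OF eqv_trans[OF *]]] by blast
qed

text \<open>If the swap moves \<open>x\<close>, both of its colors lie in \<open>L x\<close>, so
  they can be exchanged on all vertices of \<open>C\<close> that have them; otherwise
  \<open>C\<close> is left alone.\<close>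

private lemma lift_outside:
  assumes "eqv (V - C) L \<phi>' \<psi>" and \<phi>: "\<phi> \<in> col V L"
    and agree: "\<And>v. v \<in> V - C \<Longrightarrow> \<phi> v = \<phi>' v"
  shows "\<exists>\<chi>. \<chi> \<in> col V L \<and> eqv V L \<phi> \<chi> \<and> (\<forall>v \<in> V - C. \<chi> v = \<psi> v)"
  using assms(1)
proof (induction rule: rtrancl_induct)
  case base
  then show ?case using \<phi> agree by blast
next
  case (step \<psi>1 \<psi>2)
  obtain \<chi> where \<chi>: "\<chi> \<in> col V L" "eqv V L \<phi> \<chi>" "\<forall>v \<in> V - C. \<chi> v = \<psi>1 v"
    using step.IH by blast
  obtain \<alpha> \<beta> K where \<psi>1: "\<psi>1 \<in> col (V - C) L" and \<psi>2: "\<psi>2 \<in> col (V - C) L"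
    and K: "closed_in {v \<in> V - C. \<psi>1 v \<in> {\<alpha>, \<beta>}} K"
    and eq: "\<forall>v \<in> V - C. \<psi>2 v = (if v \<in> K then transpose \<alpha> \<beta> (\<psi>1 v) else \<psi>1 v)"
    using step.hyps(2) unfolding step_def by blast
  define K' where "K' = K \<union> (if x \<in> K then {v \<in> C. \<chi> v \<in> {\<alpha>, \<beta>}} else {})"
  let ?\<chi> = "\<lambda>v. if v \<in> K' then transpose \<alpha> \<beta> (\<chi> v) else \<chi> v"
  have KV: "K \<subseteq> V - C" "\<And>v. v \<in> K \<Longrightarrow> \<chi> v \<in> {\<alpha>, \<beta>}"
    using K \<chi>(3) by (auto simp: closed_in_def)
  have K'_out: "v \<in> K' \<longleftrightarrow> v \<in> K" if "v \<in> V - C" for v using that by (auto simp: K'_def)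
  have xL: "\<alpha> \<in> L x \<and> \<beta> \<in> L x" if "x \<in> K"
    using that K eq col_in[OF \<psi>1, of x] col_in[OF \<psi>2, of x] by (auto simp: closed_in_def)
  have st: "(\<chi>, ?\<chi>) \<in> step V L"
  proof (rule stepI[OF \<chi>(1)])
    show "closed_in {v \<in> V. \<chi> v \<in> {\<alpha>, \<beta>}} K'"
      unfolding closed_in_def
    proof (intro conjI ballI impI)
      show "K' \<subseteq> {v \<in> V. \<chi> v \<in> {\<alpha>, \<beta>}}" using KV CV by (auto simp: K'_def)
      fix s t assume st: "s \<in> K'" "t \<in> {v \<in> V. \<chi> v \<in> {\<alpha>, \<beta>}}" "E s t"
      show "t \<in> K'"
      proof (cases "s \<in> K")
        case True
        show ?thesis
        proof (cases "t \<in> C")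
          case t: True
          have "s = x" using leaf_adj[OF l t sym[OF st(3)]] True KV by blast
          then show ?thesis using True t st by (auto simp: K'_def)
        next
          case False
          then have "t \<in> K" using True K st \<chi>(3) unfolding closed_in_def by auto
          then show ?thesis by (simp add: K'_def)
        qed
      next
        case False
        then have "x \<in> K" "s \<in> C" using st(1) by (auto simp: K'_def split: if_splits)
        then show ?thesis using leaf_adj[OF l, of s t] st by (auto simp: K'_def)
      qed
    qed
    show "transpose \<alpha> \<beta> (\<chi> v) \<in> L v" if "v \<in> K'" for v
    proof (cases "v \<in> K")
      case True
      then have "v \<in> V - C" using KV by blast
      then show ?thesis using True \<chi>(3) eq col_in[OF \<psi>2, of v] by auto
    next
      case False
      then have v: "x \<in> K" "v \<in> C" "\<chi> v \<in> {\<alpha>, \<beta>}"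
        using that by (auto simp: K'_def split: if_splits)
      have "{\<alpha>, \<beta>} \<subseteq> L v" unfolding const[OF v(2)] using xL[OF v(1)] by simp
      then show ?thesis using transpose_in_pair[OF v(3)] by (rule subsetD)
    qed
  qed simp
  have "\<forall>v \<in> V - C. ?\<chi> v = \<psi>2 v" using K'_out \<chi>(3) eq by auto
  then show ?case using st \<chi>(2) step_col[OF st]
    by (intro exI[of _ ?\<chi>]) (auto intro: rtrancl.rtrancl_into_rtrancl)
qed

text \<open>The two sides are colored separately, and a transposition of colors on the leaf makes
  them agree at \<open>x\<close>.\<close>

lemma constant_leaf_colorable: "col V L \<noteq> {}"
proof -
  obtain \<phi> \<psi> where \<phi>: "\<phi> \<in> col (V - C) L" and \<psi>: "\<psi> \<in> col (insert x C) L"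
    using leaf_side_swappable(1)[OF l, of "V - C"] leaf_side_swappable(1)[OF l, of "insert x C"] by blast
  let ?t = "transpose (\<phi> x) (\<psi> x)"
  let ?\<chi> = "\<lambda>v. if v \<in> C then ?t (\<psi> v) else \<phi> v"
  have in_x: "\<phi> x \<in> L x" "\<psi> x \<in> L x" using col_in[OF \<phi>, of x] col_in[OF \<psi>, of x] CV by auto
  have xx: "?\<chi> v = ?t (\<psi> v)" if "v \<in> insert x C" for v using that CV by auto
  have ne: "?\<chi> u \<noteq> ?\<chi> v" if "u \<in> C" "E u v" for u v
    using xx[of u] xx[of v] leaf_adj[OF l that] that col_ne[OF \<psi>, of u v]
    by (metis insertCI transpose_eq_imp_eq)
  have "?\<chi> u \<noteq> ?\<chi> v" if "u \<in> V" "v \<in> V" "E u v" for u v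
  proof -
    consider "u \<in> C" | "v \<in> C" | "u \<notin> C" "v \<notin> C" by blast
    then show ?thesis
    proof cases
      case 1
      then show ?thesis using ne that by blast
    next
      case 2
      then show ?thesis using ne[OF 2 sym[OF that(3)]] by metis
    next
      case 3
      then show ?thesis using col_ne[OF \<phi>, of u v] that by simp
    qed
  qed
  moreover have "?\<chi> v \<in> L v" if "v \<in> V" for v
  proof (cases "v \<in> C")
    case True
    then have "\<psi> v \<in> L x" using col_in[OF \<psi>, of v] const by auto
    then have "?t (\<psi> v) \<in> L x" using in_x by (auto simp: transpose_def)
    then show ?thesis using True const by simp
  next
    case False
    then show ?thesis using that col_in[OF \<phi>, of v] by simp
  qed
  ultimately have "?\<chi> \<in> col V L" unfolding col_def by blast
  then show ?thesis by blast
qed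

lemma constant_leaf_equivalent:
  assumes \<phi>: "\<phi> \<in> col V L" and \<psi>: "\<psi> \<in> col V L"
  shows "eqv V L \<phi> \<psi>"
proof -
  have sub: "V - C \<subseteq> V" by blast
  have "eqv (V - C) L \<phi> \<psi>"
    using leaf_side_swappable(2)[OF l] col_subset[OF \<phi> sub] col_subset[OF \<psi> sub] by blast
  then obtain \<chi> where \<chi>: "\<chi> \<in> col V L" "eqv V L \<phi> \<chi>" "\<forall>v \<in> V - C. \<chi> v = \<psi> v"
    using lift_outside[OF _ \<phi>] by blast
  then show ?thesis using agree_outside_equivalent[OF \<chi>(1) \<psi>] eqv_trans by blast
qed

end

section \<open>Misfits\<close>

text \<open>
  A vertex \<open>w\<close> whose color is missing from the list of a neighbor \<open>v\<close> gives slack at \<open>v\<close> once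
  \<open>w\<close> is fixed; so, if \<open>w\<close> is not a cut vertex, its color determines the coloring up to equivalence.
\<close>

definition misfit :: "'a set \<Rightarrow> ('a \<Rightarrow> 'c) \<Rightarrow> bool" where
  "misfit A \<phi> \<longleftrightarrow> (\<exists>w \<in> A. \<exists>v. E w v \<and> \<phi> w \<notin> L v)"

lemma misfit_equivalent:
  assumes conn: "connected_set (V - {w})" and w: "E w v" "\<phi> w \<notin> L v"
    and \<phi>: "\<phi> \<in> col V L" and \<psi>: "\<psi> \<in> col V L" "\<psi> w = \<phi> w"
  shows "eqv V L \<phi> \<psi>"
proof (rule equivalent_if_agree[where R = "{w}"])
  show "\<exists>v \<in> S. slack V L {w} \<phi> v" if "S \<noteq> {}" "closed_in (V - {w}) S" for S
  proof -
    have "v \<in> V - {w}" using adj_V[OF sym[OF w(1)]] w(1) irrefl by auto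
    then have "v \<in> S" using connected_setD[OF conn that] by simp
    then show ?thesis using w sym[OF w(1)] by (auto simp: slack_def)
  qed
qed (use adj_V[OF w(1)] \<phi> \<psi> in auto)

definition nonconstant_leaf :: "'a \<Rightarrow> 'a set \<Rightarrow> bool" where
  "nonconstant_leaf x C \<longleftrightarrow> leaf x C \<and> (\<exists>v \<in> C. L v \<noteq> L x)"

text \<open>Otherwise each list on \<open>C\<close> is contained in the lists of its neighbors,
  hence equal to them as all have size \<open>k\<close>, and constancy spreads over the connected
  set \<open>insert x C\<close>.\<close>

lemma nonconstant_leaf_edge:
  assumes "nonconstant_leaf x C"
  shows "\<exists>w v \<gamma>. w \<in> C \<and> E w v \<and> \<gamma> \<in> L w \<and> \<gamma> \<notin> L v"
proof (rule ccontr)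
  assume neg: "\<not> ?thesis"
  have l: "leaf x C" using assms by (simp add: nonconstant_leaf_def)
  have xC: "x \<in> V" "C \<subseteq> V" using l leaf_subset[OF l] by (auto simp: leaf_def)
  have eq: "L w = L v" if wv: "w \<in> C" "E w v" for w v
  proof (rule ccontr)
    assume "L w \<noteq> L v"
    then obtain \<gamma> where "\<gamma> \<in> L w" "\<gamma> \<notin> L v"
      using list_diff_nonempty[OF adj_V[OF wv(2)] adj_V[OF sym[OF wv(2)]]] by blast
    with neg \<open>w \<in> C\<close> \<open>E w v\<close> show False by blast
  qed
  have "connected_set (insert x C)"
    unfolding connected_set_def
  proof (intro allI impI)
    fix S assume S: "S \<noteq> {}" "closed_in (insert x C) S"
    have root: "x \<in> T" if "T \<noteq> {}" "closed_in (insert x C) T" for T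
      using leaf_root_mem[OF l, of "insert x C" "{}" T] connected_V that by simp
    have "insert x C - S = {}" using root[OF S] root[OF _ closed_in_Diff[OF S(2)]] by blast
    then show "S = insert x C" using S(2) by (auto simp: closed_in_def)
  qed
  then have "L v = L x" if "v \<in> C" for v
  proof (rule connected_set_const)
    show "L a = L b" if "a \<in> insert x C" "b \<in> insert x C" "E a b" for a b
      using that eq[of a b] eq[of b a] sym[of a b] irrefl by auto
  qed (use that in auto)
  then show False using assms by (auto simp: nonconstant_leaf_def)
qed

text \<open>The vertices \<open>w\<close> and \<open>w'\<close> are not adjacent, and coloring
  \<open>w\<close> with \<gamma> gives slack at \<open>v\<close>. It remains to see that
  \<open>v\<close> lies in every component of \<open>V - {w, w'}\<close>.\<close>

lemma two_misfits:
  assumes l: "leaf x C" "leaf x' C'" and disj: "C \<inter> C' = {}" "x \<notin> C'" "x' \<notin> C"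
    and w: "w \<in> C" "E w v" "\<gamma> \<in> L w" "\<gamma> \<notin> L v"
    and w': "w' \<in> C'" "\<gamma>' \<in> L w'"
  obtains \<chi> where "\<chi> \<in> col V L" "\<chi> w = \<gamma>" "\<chi> w' = \<gamma>'"
proof -
  have sub: "C \<subseteq> V" "C' \<subseteq> V" "w \<noteq> w'" "w \<notin> C'" "w' \<notin> C"
    using leaf_subset[OF l(1)] leaf_subset[OF l(2)] w(1) w'(1) disj by auto
  have nadj: "\<not> E w w'" "\<not> E w' w"
    using leaf_adj[OF l(1) w(1), of w'] sub disj w'(1) sym by blast+
  have v: "v \<in> V - C' - {w}"
    using leaf_adj[OF l(1) w(1,2)] disj adj_V[OF sym[OF w(2)]] w(2) irrefl by auto
  have conn: "connected_set (V - {w})" "connected_set (V - {w'})"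
    using l w(1) w'(1) by (auto simp: leaf_def)
  let ?\<rho> = "\<lambda>u. if u = w then \<gamma> else \<gamma>'"
  have "\<exists>\<chi>. \<chi> \<in> col V L \<and> (\<forall>r \<in> {w, w'}. \<chi> r = ?\<rho> r)"
  proof (rule exists_extension)
    show "?\<rho> \<in> col {w, w'} L" using w w' nadj sub irrefl by (auto simp: col_def)
    show "{w, w'} \<subseteq> V" using sub w(1) w'(1) by auto
    fix S assume S: "S \<noteq> {}" "closed_in (V - {w, w'}) S"
    have root: "x' \<in> T" if "T \<noteq> {}" "closed_in (V - C' - {w}) T" for T
      using leaf_root_mem[OF l(2) _ conn(1) _ that] w(1) disj by auto
    let ?T = "S - C'"
    have T: "closed_in (V - C' - {w}) ?T" using S(2) w'(1) by (auto simp: closed_in_def)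
    \<comment> \<open>A closed set within \<open>C'\<close> would contain the root
      \<open>x'\<close>, which is not in \<open>C'\<close>.\<close>
    have "?T \<noteq> {}"
    proof
      assume "?T = {}"
      then have "S \<subseteq> C'" by blast
      then have "closed_in (insert x' C' - {w'}) S"
        using S(2) sub w'(1) l(2) leaf_subset[OF l(2)] disj w(1)
        unfolding closed_in_def leaf_def by blast
      moreover have "x' \<notin> {w'}" using leaf_subset[OF l(2)] w'(1) by auto
      ultimately have "x' \<in> S" using leaf_root_mem[OF l(2) _ conn(2) _ S(1)] by blast
      then show False using \<open>S \<subseteq> C'\<close> leaf_subset[OF l(2)] by auto
    qed
    \<comment> \<open>Two complementary nonempty closed sets would both contain
      \<open>x'\<close>.\<close>
    then have "V - C' - {w} - ?T = {}" using root[OF _ T] root[OF _ closed_in_Diff[OF T]] by blast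
    then have "v \<in> S" using v by blast
    then show "\<exists>v \<in> S. slack V L {w, w'} ?\<rho> v" using w(2,4) sym[OF w(2)] by (auto simp: slack_def)
  qed
  then show thesis using that sub(3) by auto
qed

lemma misfit_exists:
  assumes "nonconstant_leaf x C"
  shows "\<exists>\<chi>. \<chi> \<in> col V L \<and> misfit C \<chi>"
proof -
  have l: "leaf x C" using assms by (simp add: nonconstant_leaf_def)
  obtain w v \<gamma> where w: "w \<in> C" "E w v" "\<gamma> \<in> L w" "\<gamma> \<notin> L v"
    using nonconstant_leaf_edge[OF assms] by blast
  have "\<exists>\<psi>. \<psi> \<in> col V L \<and> (\<forall>r \<in> {w}. \<psi> r = \<gamma>)"
  proof (rule exists_extension)
    show "(\<lambda>_. \<gamma>) \<in> col {w} L" using w irrefl by (auto simp: col_def)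
    fix S assume S: "S \<noteq> {}" "closed_in (V - {w}) S"
    have "v \<in> V - {w}" using adj_V[OF sym[OF w(2)]] w(2) irrefl by auto
    moreover have "connected_set (V - {w})" using l w(1) by (auto simp: leaf_def)
    ultimately have "v \<in> S" using connected_setD[OF _ S] by blast
    then show "\<exists>v \<in> S. slack V L {w} (\<lambda>_. \<gamma>) v" using w sym[OF w(2)] by (auto simp: slack_def)
  qed (use adj_V[OF w(2)] in auto)
  then show ?thesis using w by (auto simp: misfit_def)
qed

text \<open>Misfits in different leaves are joined through a coloring that shows both. Two misfits
  in the same leaf are joined through a coloring with a misfit in the other leaf.\<close>

lemma misfits_equivalent:
  assumes n: "nonconstant_leaf x C" "nonconstant_leaf x' C'"
    and disj: "C \<inter> C' = {}" "x \<notin> C'" "x' \<notin> C"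
    and \<phi>: "\<phi> \<in> col V L" "misfit (C \<union> C') \<phi>" and \<psi>: "\<psi> \<in> col V L" "misfit (C \<union> C') \<psi>"
  shows "eqv V L \<phi> \<psi>"
proof -
  have cross: "eqv V L \<phi> \<psi>"
    if a: "leaf x C" "leaf x' C'" "C \<inter> C' = {}" "x \<notin> C'" "x' \<notin> C"
      "\<phi> \<in> col V L" "\<psi> \<in> col V L" "misfit C \<phi>" "misfit C' \<psi>" for x C x' C' \<phi> \<psi>
  proof -
    obtain w v where w: "w \<in> C" "E w v" "\<phi> w \<notin> L v" using a(8) by (auto simp: misfit_def)
    obtain w' v' where w': "w' \<in> C'" "E w' v'" "\<psi> w' \<notin> L v'" using a(9) by (auto simp: misfit_def)
    have "\<phi> w \<in> L w" "\<psi> w' \<in> L w'" using col_in[OF a(6) adj_V[OF w(2)]] col_in[OF a(7) adj_V[OF w'(2)]] .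
    then obtain \<chi> where \<chi>: "\<chi> \<in> col V L" "\<chi> w = \<phi> w" "\<chi> w' = \<psi> w'"
      using two_misfits[OF a(1-5) w(1,2) _ w(3) w'(1)] by metis
    have "connected_set (V - {w})" "connected_set (V - {w'})"
      using a(1,2) w(1) w'(1) by (auto simp: leaf_def)
    then have "eqv V L \<phi> \<chi>" "eqv V L \<psi> \<chi>"
      using misfit_equivalent[of w v \<phi> \<chi>] misfit_equivalent[of w' v' \<psi> \<chi>] w w' \<chi> a by auto
    then show ?thesis using eqv_trans[OF _ eqv_sym] by blast
  qed
  have l: "leaf x C" "leaf x' C'" using n by (auto simp: nonconstant_leaf_def)
  obtain \<chi> \<chi>' where \<chi>: "\<chi> \<in> col V L" "misfit C \<chi>" "\<chi>' \<in> col V L" "misfit C' \<chi>'"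
    using misfit_exists[OF n(1)] misfit_exists[OF n(2)] by blast
  have disj': "C' \<inter> C = {}" using disj by blast
  note cr = cross[OF l disj] and cr' = cross[OF l(2,1) disj' disj(3,2)]
  have "misfit C \<phi> \<or> misfit C' \<phi>" "misfit C \<psi> \<or> misfit C' \<psi>" using \<phi> \<psi> by (auto simp: misfit_def)
  then consider "misfit C \<phi>" "misfit C \<psi>" | "misfit C \<phi>" "misfit C' \<psi>" | "misfit C' \<phi>" "misfit C \<psi>"
    | "misfit C' \<phi>" "misfit C' \<psi>" by blast
  then show ?thesis
  proof cases
    case 1
    show ?thesis
      using eqv_trans[OF cr[OF \<phi>(1) \<chi>(3) 1(1) \<chi>(4)] cr'[OF \<chi>(3) \<psi>(1) \<chi>(4) 1(2)]] .
  next
    case 2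
    then show ?thesis using cr \<phi> \<psi> by blast
  next
    case 3
    then show ?thesis using cr' \<phi> \<psi> by blast
  next
    case 4
    show ?thesis
      using eqv_trans[OF cr'[OF \<phi>(1) \<chi>(1) 4(1) \<chi>(2)] cr[OF \<chi>(1) \<psi>(1) \<chi>(2) 4(2)]] .
  qed
qed


text \<open>With everything outside the leaf fixed, slack at the root makes all colorings of
  \<open>insert x C\<close> equivalent. It survives the additional fixing of \<open>w\<close>, so
  one of them gives \<open>w\<close> the color \<gamma>.\<close>

lemma to_misfit_if_slack_outside:
  assumes n: "nonconstant_leaf x C" and \<phi>: "\<phi> \<in> col V L"
    and sl: "slack V L (V - insert x C) \<phi> x"
  shows "\<exists>\<psi>. \<psi> \<in> col V L \<and> eqv V L \<phi> \<psi> \<and> misfit C \<psi>"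
proof -
  have l: "leaf x C" using n by (simp add: nonconstant_leaf_def)
  have xC: "x \<in> V" "C \<subseteq> V" "x \<notin> C" using l leaf_subset[OF l] by (auto simp: leaf_def)
  obtain w v \<gamma> where w: "w \<in> C" "E w v" "\<gamma> \<in> L w" "\<gamma> \<notin> L v"
    using nonconstant_leaf_edge[OF n] by blast
  let ?R = "V - insert x C" and ?\<rho> = "\<phi>(w := \<gamma>)"
  have nadj: "\<not> E w r" "\<not> E r w" if "r \<in> ?R" for r
    using leaf_adj[OF l w(1), of r] that sym by blast+
  have R: "insert w ?R \<subseteq> V" using w xC by blast
  have "\<exists>\<psi>. \<psi> \<in> col V L \<and> (\<forall>r \<in> insert w ?R. \<psi> r = ?\<rho> r)"
  proof (rule exists_extension[OF R])
    show "?\<rho> \<in> col (insert w ?R) L"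
      using col_subset[OF \<phi> R] w nadj irrefl unfolding col_def by auto
    fix S assume S: "S \<noteq> {}" "closed_in (V - insert w ?R) S"
    have eq: "V - insert w ?R = insert x C - {w}" using xC w by blast
    have "connected_set (V - {w})" "x \<notin> {w}" using l w(1) xC by (auto simp: leaf_def)
    then have "x \<in> S" using leaf_root_mem[OF l _ _ _ S(1) S(2)[unfolded eq]] by blast
    moreover have "slack V L (insert w ?R) ?\<rho> x"
      using sl w(1) by (auto simp: slack_def)
    ultimately show "\<exists>v \<in> S. slack V L (insert w ?R) ?\<rho> v" by blast
  qed
  then obtain \<psi> where \<psi>: "\<psi> \<in> col V L" "\<And>r. r \<in> insert w ?R \<Longrightarrow> \<psi> r = ?\<rho> r" by blast
  have "eqv V L \<phi> \<psi>"
  proof (rule equivalent_if_agree[OF _ \<phi> \<psi>(1)])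
    show "?R \<subseteq> V" by blast
    show "\<psi> r = \<phi> r" if "r \<in> ?R" for r using \<psi>(2)[of r] that w(1) by auto
    fix S assume S: "S \<noteq> {}" "closed_in (V - ?R) S"
    have eq: "V - ?R = insert x C - {}" using xC by blast
    have "x \<in> S" using leaf_root_mem[OF l _ _ _ S(1) S(2)[unfolded eq]] connected_V by simp
    then show "\<exists>v \<in> S. slack V L ?R \<phi> v" using sl by blast
  qed
  moreover have "misfit C \<psi>" using \<psi>(2)[of w] w by (auto simp: misfit_def)
  ultimately show ?thesis using \<psi>(1) by blast
qed

text \<open>Here \<open>C\<close> is fixed instead, and slack at its root frees the rest of the
  graph, where \<open>C'\<close> lies.\<close>

lemma to_misfit_if_slack_inside:
  assumes l: "leaf x C" and n': "nonconstant_leaf x' C'"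
    and disj: "C \<inter> C' = {}" "x \<notin> C'" and \<phi>: "\<phi> \<in> col V L"
    and sl: "slack V L C \<phi> x"
  shows "\<exists>\<psi>. \<psi> \<in> col V L \<and> eqv V L \<phi> \<psi> \<and> misfit C' \<psi>"
proof -
  have l': "leaf x' C'" using n' by (simp add: nonconstant_leaf_def)
  have xC: "x \<in> V" "C \<subseteq> V" "x \<notin> C" using l leaf_subset[OF l] by (auto simp: leaf_def)
  obtain w v \<gamma> where w: "w \<in> C'" "E w v" "\<gamma> \<in> L w" "\<gamma> \<notin> L v"
    using nonconstant_leaf_edge[OF n'] by blast
  let ?\<rho> = "\<phi>(w := \<gamma>)"
  have wC: "w \<notin> insert x C" "w \<in> V" using w disj adj_V by auto
  have nadj: "\<not> E w r" "\<not> E r w" if "r \<in> C" for r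
    using leaf_adj[OF l that, of w] wC sym by blast+
  have R: "insert w C \<subseteq> V" using wC xC by blast
  have "\<exists>\<psi>. \<psi> \<in> col V L \<and> (\<forall>r \<in> insert w C. \<psi> r = ?\<rho> r)"
  proof (rule exists_extension[OF R])
    show "?\<rho> \<in> col (insert w C) L"
      using col_subset[OF \<phi> R] w nadj irrefl unfolding col_def by auto
    fix S assume S: "S \<noteq> {}" "closed_in (V - insert w C) S"
    have eq: "V - insert w C = V - C - {w}" by blast
    have "connected_set (V - {w})" "x \<notin> {w}" using l' w(1) wC by (auto simp: leaf_def)
    then have "x \<in> S" using leaf_root_mem[OF l _ _ _ S(1) S(2)[unfolded eq]] by blast
    moreover have "slack V L (insert w C) ?\<rho> x"
    proof -
      have "?\<rho> r = \<phi> r" if "r \<in> C" for r using that wC by auto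
      then show ?thesis using sl unfolding slack_def by (metis insertCI)
    qed
    ultimately show "\<exists>v \<in> S. slack V L (insert w C) ?\<rho> v" by blast
  qed
  then obtain \<psi> where \<psi>: "\<psi> \<in> col V L" "\<And>r. r \<in> insert w C \<Longrightarrow> \<psi> r = ?\<rho> r" by blast
  have "eqv V L \<phi> \<psi>"
  proof (rule equivalent_if_agree[OF _ \<phi> \<psi>(1)])
    show "C \<subseteq> V" using xC by blast
    show "\<psi> r = \<phi> r" if "r \<in> C" for r using \<psi>(2)[of r] that wC(1) by auto
    fix S assume S: "S \<noteq> {}" "closed_in (V - C) S"
    have "x \<in> S" using leaf_root_mem[OF l, of "V - C" "{}" S] S connected_V by simp
    then show "\<exists>v \<in> S. slack V L C \<phi> v" using sl by blast
  qed
  moreover have "misfit C' \<psi>" using \<psi>(2)[of w] w by (auto simp: misfit_def)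
  ultimately show ?thesis using \<psi>(1) by blast
qed

section \<open>Reaching a misfit\<close>

context
  fixes x C y z \<phi> c
  assumes l: "leaf x C" and \<phi>: "\<phi> \<in> col V L"
    and y: "y \<in> C" "E x y" and z: "z \<in> V - insert x C" "E x z"
    and \<phi>yz: "\<phi> y = c" "\<phi> z = c" and cx: "c \<in> L x"
begin

text \<open>The part left free once \<open>y\<close> and everything outside the leaf are fixed. Both
  \<open>y\<close> and \<open>z\<close> are then fixed neighbors of \<open>x\<close> with the same
  color \<open>c\<close>.\<close>

private definition H :: "'a set" where "H = insert x C - {y}"
private definition R :: "'a set" where "R = insert y (V - insert x C)"
private definition Cls :: "('a \<Rightarrow> 'c) set" where "Cls = {\<psi> \<in> col V L. \<forall>r \<in> R. \<psi> r = \<phi> r}"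

private lemma basics: "x \<in> V" "C \<subseteq> V" "x \<notin> C" "y \<noteq> x" "y \<noteq> z" "z \<noteq> x" "z \<notin> C" "z \<in> V" "y \<in> V"
  using l leaf_subset[OF l] y z by (auto simp: leaf_def)

private lemma H_R: "V - R = H" "R \<subseteq> V" "x \<in> H" "H \<subseteq> V" "y \<notin> H" "y \<in> R" "z \<in> R" "H - {x} = C - {y}"
  using basics y z by (auto simp: H_def R_def)

private lemma \<phi>_Cls: "\<phi> \<in> Cls" using \<phi> by (simp add: Cls_def)

private lemma Cls_col: "\<psi> \<in> Cls \<Longrightarrow> \<psi> \<in> col V L" by (simp add: Cls_def)

private lemma Cls_y: "\<psi> \<in> Cls \<Longrightarrow> \<psi> y = c" using H_R \<phi>yz by (simp add: Cls_def)

private lemma H_adj: "a \<in> H \<Longrightarrow> a \<noteq> x \<Longrightarrow> E a b \<Longrightarrow> b \<in> H \<or> b = y"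
  using leaf_adj[OF l, of a b] by (auto simp: H_def)

private lemma H_root: "S \<noteq> {} \<Longrightarrow> closed_in H S \<Longrightarrow> x \<in> S"
  using leaf_root_mem[OF l, of "insert x C" "{y}" S] l y basics by (auto simp: H_def leaf_def)

private lemma connected_H: "connected_set H"
  unfolding connected_set_def
proof (intro allI impI)
  fix S assume S: "S \<noteq> {}" "closed_in H S"
  have "H - S = {}" using H_root[OF S] H_root[OF _ closed_in_Diff[OF S(2)]] by blast
  then show "S = H" using S(2) by (auto simp: closed_in_def)
qed

text \<open>The equal colors of \<open>y\<close> and \<open>z\<close> give slack at
  \<open>x\<close>, and every nonempty closed subset of \<open>H\<close> contains
  \<open>x\<close>.\<close>

private lemma Cls_equivalent: "\<psi> \<in> Cls \<Longrightarrow> eqv V L \<phi> \<psi>"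
proof (rule equivalent_if_agree[OF H_R(2) \<phi>])
  fix S assume "S \<noteq> {}" "closed_in (V - R) S"
  then have "x \<in> S" using H_root H_R(1) by simp
  moreover have "slack V L R \<phi> x" using H_R y z basics \<phi>yz unfolding slack_def by metis
  ultimately show "\<exists>v \<in> S. slack V L R \<phi> v" by blast
qed (auto simp: Cls_def)

section \<open>The lists when no extension has a misfit\<close>

context
  assumes fit: "\<And>\<psi>. \<psi> \<in> Cls \<Longrightarrow> \<not> misfit C \<psi>"
    and tight: "\<And>\<psi> a. \<psi> \<in> Cls \<Longrightarrow> a \<in> C \<Longrightarrow> a \<noteq> y \<Longrightarrow> E x a \<Longrightarrow> \<psi> a \<noteq> c"
begin

private lemma fitD: "\<psi> \<in> Cls \<Longrightarrow> w \<in> C \<Longrightarrow> E w v \<Longrightarrow> \<psi> w \<in> L v"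
  using fit by (auto simp: misfit_def)

private lemma c_in_nbr: "E y u \<Longrightarrow> c \<in> L u"
  using fitD[OF \<phi>_Cls y(1)] \<phi>yz by blast

text \<open>A component of \<open>H - {w}\<close> that \<open>w\<close> cuts off from
  \<open>x\<close>.\<close>

private definition lobe :: "'a \<Rightarrow> 'a set \<Rightarrow> bool" where
  "lobe w Q \<longleftrightarrow> Q \<noteq> {} \<and> closed_in (H - {w}) Q \<and> x \<notin> Q \<and> connected_set Q"

text \<open>The set \<open>Q\<close> can be colored around \<open>y\<close> with color
  \<open>c\<close> and \<open>w\<close> with color \<gamma>. For a lobe these are the only neighbors
  outside it.\<close>

private definition unblocked :: "'a \<Rightarrow> 'c \<Rightarrow> 'a set \<Rightarrow> bool" where
  "unblocked w \<gamma> Q \<longleftrightarrow>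
     (\<exists>\<chi> \<in> col Q L. \<forall>u \<in> Q. (E u y \<longrightarrow> \<chi> u \<noteq> c) \<and> (E u w \<longrightarrow> \<chi> u \<noteq> \<gamma>))"

private lemma lobe_sub: "lobe w Q \<Longrightarrow> Q \<subseteq> H - {w}" "lobe w Q \<Longrightarrow> Q \<subseteq> C - {y}"
  using H_R(8) by (auto simp: lobe_def closed_in_def)

text \<open>Otherwise \<open>w\<close> would separate \<open>Q\<close> from \<open>x\<close> in the
  whole graph, but no vertex of \<open>C\<close> is a cut vertex.\<close>

private lemma lobe_nbr_y:
  assumes w: "w \<in> H - {x}" and Q: "lobe w Q" shows "\<exists>u \<in> Q. E y u"
proof (rule ccontr)
  assume neg: "\<not> ?thesis"
  have "closed_in (V - {w}) Q"
    unfolding closed_in_def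
  proof (intro conjI ballI impI)
    show "Q \<subseteq> V - {w}" using lobe_sub(1)[OF Q] H_R(4) by blast
    fix s t assume st: "s \<in> Q" "t \<in> V - {w}" "E s t"
    have "s \<in> H" "s \<noteq> x" "t \<noteq> y" using lobe_sub[OF Q] Q st neg sym[OF st(3)] by (auto simp: lobe_def)
    then have "t \<in> H - {w}" using H_adj[OF _ _ st(3)] st(2) by blast
    then show "t \<in> Q" using Q st unfolding lobe_def closed_in_def by blast
  qed
  moreover have "connected_set (V - {w})" using l w H_R(8) by (auto simp: leaf_def)
  ultimately have "Q = V - {w}" using connected_setD Q unfolding lobe_def by blast
  then show False using Q w basics by (auto simp: lobe_def)
qed

private lemma lobe_nbr:
  assumes w: "w \<in> H - {x}" and Q: "lobe w Q" shows "\<exists>u \<in> Q. E w u"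
proof (rule ccontr)
  assume neg: "\<not> ?thesis"
  then have "closed_in H Q" using Q sym unfolding lobe_def closed_in_def by blast
  then show False using H_root Q by (auto simp: lobe_def)
qed

text \<open>A lobe of \<open>a\<close> containing \<open>w\<close> would leave a proper closed
  subset of the connected set \<open>H\<close> around \<open>x\<close>. Without \<open>w\<close>,
  its part outside \<open>Q\<close> is closed in \<open>H\<close> and misses \<open>x\<close>, so it
  is empty.\<close>

private lemma nested_lobe:
  assumes w: "w \<in> H - {x}" and Q: "lobe w Q" and a: "a \<in> Q" and Q': "lobe a Q'"
  shows "Q' \<subseteq> Q - {a}"
proof -
  have out: "t \<notin> Q" if "s \<in> H" "s \<notin> Q" "s \<noteq> w" "E s t" for s t
    using Q that sym[OF that(4)] unfolding lobe_def closed_in_def by blast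
  have aw: "a \<noteq> w" "a \<in> H" "x \<noteq> a" using lobe_sub(1)[OF Q] a Q by (auto simp: lobe_def)
  have cl: "closed_in H (T - Q)" if T: "closed_in (H - {a}) T" "w \<notin> T" for T
    unfolding closed_in_def
  proof (intro conjI ballI impI)
    show "T - Q \<subseteq> H" using T by (auto simp: closed_in_def)
    fix s t assume st: "s \<in> T - Q" "t \<in> H" "E s t"
    have "t \<notin> Q" using out[of s t] st T by (auto simp: closed_in_def)
    moreover from this have "t \<in> T" using T(1) st a unfolding closed_in_def by blast
    ultimately show "t \<in> T - Q" by blast
  qed
  have Q'cl: "closed_in (H - {a}) Q'" "x \<notin> Q'" using Q' by (auto simp: lobe_def)
  have "w \<notin> Q'"
  proof
    assume "w \<in> Q'"
    then have "closed_in H (H - {a} - Q' - Q)" by (intro cl closed_in_Diff[OF Q'cl(1)]) blast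
    moreover have "x \<in> H - {a} - Q' - Q" using aw H_R(3) Q'cl Q by (auto simp: lobe_def)
    ultimately have "H - {a} - Q' - Q = H" by (intro connected_setD[OF connected_H]) auto
    then show False using aw(2) by blast
  qed
  then have "Q' - Q = {}" using H_root[OF _ cl[OF Q'cl(1)]] Q'cl(2) by blast
  then show ?thesis using Q'cl(1) by (auto simp: closed_in_def)
qed

private lemma unblocked_Un:
  assumes "unblocked w \<gamma> S" "unblocked w \<gamma> T" "closed_in (S \<union> T) S" "S \<inter> T = {}"
  shows "unblocked w \<gamma> (S \<union> T)"
proof -
  obtain \<chi> \<chi>' where \<chi>: "\<chi> \<in> col S L" "\<forall>u \<in> S. (E u y \<longrightarrow> \<chi> u \<noteq> c) \<and> (E u w \<longrightarrow> \<chi> u \<noteq> \<gamma>)"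
    and \<chi>': "\<chi>' \<in> col T L" "\<forall>u \<in> T. (E u y \<longrightarrow> \<chi>' u \<noteq> c) \<and> (E u w \<longrightarrow> \<chi>' u \<noteq> \<gamma>)"
    using assms(1,2) unfolding unblocked_def by blast
  have nadj: "\<not> E s t" "\<not> E t s" if "s \<in> S" "t \<in> T" for s t
    using that assms(3,4) sym unfolding closed_in_def by blast+
  let ?\<chi> = "\<lambda>u. if u \<in> S then \<chi> u else \<chi>' u"
  have "?\<chi> \<in> col (S \<union> T) L"
    using \<chi>(1) \<chi>'(1) nadj assms(4) unfolding col_def by auto
  moreover have "(E u y \<longrightarrow> ?\<chi> u \<noteq> c) \<and> (E u w \<longrightarrow> ?\<chi> u \<noteq> \<gamma>)" if "u \<in> S \<union> T" for u
    using \<chi>(2) \<chi>'(2) that by auto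
  ultimately show ?thesis unfolding unblocked_def by (intro bexI[of _ ?\<chi>]) blast+
qed

text \<open>
  All parts of \<open>H - {w}\<close> that contain \<open>x\<close> or \<open>v\<close> have slack once \<open>w\<close> gets the color \<open>\<gamma>\<close>; since
  \<open>w\<close> must not become a misfit, some other part obstructs this color.
\<close>

private lemma blocking_lobe:
  assumes w: "w \<in> H - {x}" and v: "E w v" "v \<in> H" and \<gamma>: "\<gamma> \<in> L w" "\<gamma> \<notin> L v" "E w y \<longrightarrow> \<gamma> \<noteq> c"
  shows "\<exists>Q. lobe w Q \<and> \<not> unblocked w \<gamma> Q"
proof -
  \<comment> \<open>The union \<open>S0\<close> of this family consists of the components of
    \<open>H - {w}\<close> that contain neither \<open>x\<close> nor \<open>v\<close>.\<close>
  define F where "F = {S. closed_in (H - {w}) S \<and> x \<notin> S \<and> v \<notin> S}"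
  define S0 where "S0 = \<Union>F"
  have S0: "S0 \<in> F" unfolding F_def S0_def closed_in_def by blast
  have S0H: "S0 \<subseteq> H - {w}" "x \<notin> S0" "v \<notin> S0" using S0 by (auto simp: F_def closed_in_def)
  have w': "w \<in> C" "w \<noteq> y" "w \<in> H" "w \<notin> R" using w H_R by auto
  have not_unblocked: "\<not> unblocked w \<gamma> S0"
  proof
    assume "unblocked w \<gamma> S0"
    then obtain \<chi> where \<chi>: "\<chi> \<in> col S0 L"
      "\<And>u. u \<in> S0 \<Longrightarrow> E u y \<Longrightarrow> \<chi> u \<noteq> c" "\<And>u. u \<in> S0 \<Longrightarrow> E u w \<Longrightarrow> \<chi> u \<noteq> \<gamma>"
      unfolding unblocked_def by blast
    define \<rho> where "\<rho> u = (if u \<in> S0 then \<chi> u else if u = w then \<gamma> else \<phi> u)" for u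
    let ?R = "insert w (R \<union> S0)"
    have RV: "?R \<subseteq> V" using w' S0H H_R by blast
    have \<rho>R: "\<rho> r = \<phi> r" if "r \<in> R" for r
    proof -
      have "r \<notin> S0" "r \<noteq> w" using that S0H(1) w' H_R(1) by blast+
      then show ?thesis by (simp add: \<rho>_def)
    qed
    have \<rho>w: "\<rho> w = \<gamma>" using S0H(1) by (auto simp: \<rho>_def)
    have HR: "r = y" if "s \<in> H" "s \<noteq> x" "r \<in> R" "E s r" for s r
      using H_adj[OF that(1,2,4)] H_R(1) that(3) by blast
    have ne: "\<rho> s \<noteq> \<rho> t" if st: "s \<in> S0" "t \<in> ?R" "E s t" for s t
    proof -
      have s: "s \<in> H" "s \<noteq> x" "\<rho> s = \<chi> s" using st(1) S0H by (auto simp: \<rho>_def)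
      consider "t \<in> S0" | "t = w" | "t \<in> R" using st(2) by blast
      then show ?thesis
      proof cases
        case 1
        then show ?thesis using col_ne[OF \<chi>(1) st(1) 1 st(3)] s by (simp add: \<rho>_def)
      next
        case 2
        then show ?thesis using \<chi>(3)[OF st(1)] st(3) s \<rho>w by auto
      next
        case 3
        then have "t = y" using HR s st by blast
        then show ?thesis using \<chi>(2)[OF st(1)] st(3) s \<rho>R[OF 3] \<phi>yz by auto
      qed
    qed
    have ne_w: "\<rho> w \<noteq> \<rho> t" if "t \<in> R" "E w t" for t
      using HR[of w t] that w w' \<rho>R[OF that(1)] \<rho>w \<gamma>(3) \<phi>yz by auto
    have "\<rho> s \<noteq> \<rho> t" if st: "s \<in> ?R" "t \<in> ?R" "E s t" for s t
    proof -
      consider "s \<in> S0" | "t \<in> S0" | "s = w" "t \<in> R" | "t = w" "s \<in> R" | "s \<in> R" "t \<in> R"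
        using st irrefl by blast
      then show ?thesis
      proof cases
        case 5
        then show ?thesis using \<rho>R col_ne[OF \<phi> _ _ st(3)] H_R(2) by auto
      qed (use ne[of s t] ne[of t s] ne_w[of s] ne_w[of t] st sym[OF st(3)] in auto)
    qed
    moreover have "\<rho> s \<in> L s" if "s \<in> ?R" for s
      using that col_in[OF \<chi>(1), of s] col_in[OF \<phi>, of s] RV \<gamma>(1) by (auto simp: \<rho>_def)
    ultimately have \<rho>: "\<rho> \<in> col ?R L" unfolding col_def by blast
    have "\<exists>\<psi>. \<psi> \<in> col V L \<and> (\<forall>r \<in> ?R. \<psi> r = \<rho> r)"
    proof (rule exists_extension[OF RV \<rho>])
      fix S assume S: "S \<noteq> {}" "closed_in (V - ?R) S"
      have eq: "V - ?R = H - {w} - S0" using H_R(1) by blast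
      have "closed_in (H - {w}) S"
        unfolding closed_in_def
      proof (intro conjI ballI impI)
        show "S \<subseteq> H - {w}" using S(2) unfolding eq closed_in_def by blast
        fix s t assume st: "s \<in> S" "t \<in> H - {w}" "E s t"
        have s: "s \<in> H - {w}" "s \<notin> S0" using S(2) st(1) unfolding eq closed_in_def by blast+
        have "t \<notin> S0"
        proof
          assume "t \<in> S0"
          then have "s \<in> S0" using S0 s sym[OF st(3)] unfolding F_def closed_in_def by blast
          then show False using s by blast
        qed
        then show "t \<in> S" using S(2) st unfolding eq closed_in_def by blast
      qed
      \<comment> \<open>Otherwise \<open>S\<close> belongs to \<open>F\<close> and lies in
        \<open>S0\<close>, although it is nonempty and disjoint from \<open>S0\<close>.\<close>
      then have "x \<in> S \<or> v \<in> S"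
      proof (rule contrapos_pp)
        assume "\<not> (x \<in> S \<or> v \<in> S)"
        moreover have "\<not> S \<subseteq> S0" using S unfolding eq closed_in_def by blast
        ultimately show "\<not> closed_in (H - {w}) S" unfolding S0_def F_def by blast
      qed
      moreover have "slack V L ?R \<rho> x"
      proof -
        have "y \<in> ?R" "z \<in> ?R" "\<rho> y = \<rho> z" using H_R(6,7) \<rho>R \<phi>yz by auto
        then show ?thesis using basics(5) y(2) z(2) unfolding slack_def by blast
      qed
      moreover have "slack V L ?R \<rho> v" using sym[OF v(1)] \<rho>w \<gamma>(2) unfolding slack_def by blast
      ultimately show "\<exists>v \<in> S. slack V L ?R \<rho> v" by blast
    qed
    then obtain \<psi> where \<psi>: "\<psi> \<in> col V L" "\<And>r. r \<in> ?R \<Longrightarrow> \<psi> r = \<rho> r" by blast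
    then have "\<psi> \<in> Cls" using \<rho>R by (simp add: Cls_def)
    then show False using fitD[OF _ w'(1) v(1)] \<psi>(2)[of w] \<rho>w \<gamma>(2) by auto
  qed
  \<comment> \<open>A smallest blocked closed set is connected, because unblocked parts without
    edges between them combine.\<close>
  define P where "P S \<longleftrightarrow> closed_in (H - {w}) S \<and> S \<subseteq> S0 \<and> \<not> unblocked w \<gamma> S" for S
  have "P S0" using S0 not_unblocked by (auto simp: P_def F_def)
  then obtain Q where Q: "P Q" "\<And>T. P T \<Longrightarrow> card Q \<le> card T"
    using ex_has_least_nat[of P S0 card] by blast
  have QH: "closed_in (H - {w}) Q" "Q \<subseteq> S0" "\<not> unblocked w \<gamma> Q" using Q(1) by (auto simp: P_def)
  have finQ: "finite Q" using QH(2) S0H(1) H_R(4) finite_V by (meson Diff_subset finite_subset subset_trans)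
  have "connected_set Q"
    unfolding connected_set_def
  proof (intro allI impI, rule ccontr)
    fix T assume T: "T \<noteq> {}" "closed_in Q T" "T \<noteq> Q"
    have TQ: "T \<subset> Q" "Q - T \<subset> Q" using T unfolding closed_in_def by blast+
    have cl: "closed_in (H - {w}) U" if "closed_in Q U" for U
      using that QH(1) unfolding closed_in_def by blast
    have small: "unblocked w \<gamma> U" if "closed_in Q U" "U \<subset> Q" for U
    proof (rule ccontr)
      assume "\<not> unblocked w \<gamma> U"
      then have "P U" using cl[OF that(1)] that(2) QH(2) by (auto simp: P_def)
      then show False using Q(2)[of U] psubset_card_mono[OF finQ that(2)] by simp
    qed
    have "T \<union> (Q - T) = Q" using TQ by blast
    then have "unblocked w \<gamma> Q"
      using unblocked_Un[OF small[OF T(2) TQ(1)] small[OF closed_in_Diff[OF T(2)] TQ(2)]] T(2) by auto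
    then show False using QH(3) by blast
  qed
  moreover have "Q \<noteq> {}" using QH(3) by (auto simp: unblocked_def col_def)
  ultimately have "lobe w Q" using QH S0H(2) by (auto simp: lobe_def)
  then show ?thesis using QH(3) by blast
qed

text \<open>
  On a lobe with constant list \<open>M\<close> the colors other than \<open>c\<close> are interchangeable, so blocking one
  of them blocks them all.
\<close>

private lemma blocked_all:
  assumes w: "w \<in> H - {x}" and Q: "lobe w Q" and M: "\<And>u. u \<in> Q \<Longrightarrow> L u = M"
    and bl: "\<not> unblocked w \<gamma> Q" and \<gamma>: "\<gamma> \<noteq> c" and \<psi>: "\<psi> \<in> Cls"
  shows "\<psi> w \<notin> M - {c}"
proof
  assume d: "\<psi> w \<in> M - {c}"
  have QV: "Q \<subseteq> V" and wV: "w \<in> V" using lobe_sub(1)[OF Q] H_R(4) w by blast+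
  have \<psi>V: "\<psi> \<in> col V L" using Cls_col[OF \<psi>] .
  have ne_y: "\<psi> u \<noteq> c" if "u \<in> Q" "E u y" for u
    using col_ne[OF \<psi>V _ basics(9) that(2)] that(1) QV Cls_y[OF \<psi>] by auto
  have ne_w: "\<psi> u \<noteq> \<psi> w" if "u \<in> Q" "E u w" for u
    using col_ne[OF \<psi>V _ wV that(2)] that(1) QV by auto
  show False
  proof (cases "\<gamma> \<in> M")
    case False
    have "\<psi> u \<noteq> \<gamma>" if "u \<in> Q" for u using False M[OF that] col_in[OF \<psi>V, of u] that QV by auto
    then have "unblocked w \<gamma> Q"
      using col_subset[OF \<psi>V QV] ne_y unfolding unblocked_def by blast
    then show False using bl by blast
  next
    case True
    \<comment> \<open>No neighbor of \<open>w\<close> has the color \<open>\<psi> w\<close>, so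
      after the exchange none has \<gamma>; neither color is \<open>c\<close>, so the neighbors of
      \<open>y\<close> still avoid \<open>c\<close>.\<close>
    let ?t = "transpose \<gamma> (\<psi> w)"
    have "?t (\<psi> u) \<in> L u" if "u \<in> Q" for u
    proof -
      have "\<psi> u \<in> M" using M[OF that] col_in[OF \<psi>V, of u] that QV by auto
      then show ?thesis using True d M[OF that] by (auto simp: transpose_def)
    qed
    moreover have "?t (\<psi> u) \<noteq> ?t (\<psi> v)" if "u \<in> Q" "v \<in> Q" "E u v" for u v
      using col_ne[OF \<psi>V _ _ that(3)] that QV by (auto dest: transpose_eq_imp_eq)
    ultimately have "?t \<circ> \<psi> \<in> col Q L" by (simp add: col_def)
    moreover have "?t (\<psi> u) \<noteq> c" if "u \<in> Q" "E u y" for u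
      using ne_y[OF that] \<gamma> d by (auto simp: transpose_def)
    moreover have "?t (\<psi> u) \<noteq> \<gamma>" if "u \<in> Q" "E u w" for u
      using ne_w[OF that] by (auto simp: transpose_def)
    ultimately have "unblocked w \<gamma> Q" unfolding unblocked_def by (metis comp_apply)
    then show False using bl by blast
  qed
qed

private definition lobes_constant :: "'a \<Rightarrow> bool" where
  "lobes_constant w \<longleftrightarrow> (\<forall>Q. lobe w Q \<longrightarrow> (\<forall>u \<in> Q. L u = L w))"

text \<open>Some lobe blocks \<gamma>. Its list is \<open>L w\<close>, so it blocks every color of
  \<open>L w\<close> other than \<open>c\<close>.\<close>

private lemma forced:
  assumes w: "w \<in> H - {x}" "lobes_constant w" and v: "E w v" "v \<in> H"
    and \<gamma>: "\<gamma> \<in> L w" "\<gamma> \<notin> L v" "\<gamma> \<noteq> c" and \<psi>: "\<psi> \<in> Cls"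
  shows "\<psi> w = c"
proof -
  obtain Q where Q: "lobe w Q" "\<not> unblocked w \<gamma> Q" using blocking_lobe[OF w(1) v \<gamma>(1,2)] \<gamma>(3) by blast
  have "\<psi> w \<notin> L w - {c}"
    using blocked_all[OF w(1) Q(1) _ Q(2) \<gamma>(3) \<psi>] w(2) Q(1) unfolding lobes_constant_def by blast
  moreover have "\<psi> w \<in> L w" using col_in[OF Cls_col[OF \<psi>]] w(1) H_R(4) by blast
  ultimately show ?thesis by blast
qed

text \<open>Each list has a color missing from the other, and such a color, unless it is
  \<open>c\<close>, forces its vertex to have color \<open>c\<close>. If neither is
  \<open>c\<close>, the edge has equal colors at its ends; if one is, the other end has color
  \<open>c\<close> outside its list.\<close>

private lemma edge_constant:
  assumes a: "a \<in> H - {x}" "lobes_constant a" and b: "b \<in> H - {x}" "lobes_constant b" and ab: "E a b"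
  shows "L a = L b"
proof (rule ccontr)
  assume ne: "L a \<noteq> L b"
  have V: "a \<in> V" "b \<in> V" using a b H_R(4) by auto
  obtain \<gamma> where \<gamma>: "\<gamma> \<in> L a" "\<gamma> \<notin> L b" using list_diff_nonempty[OF V ne] by blast
  obtain \<delta> where \<delta>: "\<delta> \<in> L b" "\<delta> \<notin> L a" using list_diff_nonempty[OF V(2,1) ne[symmetric]] by blast
  have fa: "\<phi> a = c" if "\<gamma> \<noteq> c" using forced[OF a ab _ \<gamma> that \<phi>_Cls] b by blast
  have fb: "\<phi> b = c" if "\<delta> \<noteq> c" using forced[OF b sym[OF ab] _ \<delta> that \<phi>_Cls] a by blast
  show False using fa fb \<gamma> \<delta> col_ne[OF \<phi> V ab] col_in[OF \<phi> V(1)] col_in[OF \<phi> V(2)] by metis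
qed

text \<open>Induction on the number of vertices in the lobes of \<open>w\<close>: the lobes of a
  vertex in such a lobe lie strictly inside it. So lists are constant within each lobe, and only the
  comparison with \<open>L w\<close> remains.\<close>

private lemma all_lobes_constant: "w \<in> H - {x} \<Longrightarrow> lobes_constant w"
proof (induction "card (\<Union>{Q. lobe w Q})" arbitrary: w rule: less_induct)
  case less
  have fin: "finite (\<Union>{Q. lobe w Q})"
    using lobe_sub(1) H_R(4) finite_V by (intro finite_subset[OF _ finite_V]) blast
  have IH: "lobes_constant a" "a \<in> H - {x}" if a: "a \<in> Q" "lobe w Q" for a Q
  proof -
    show aH: "a \<in> H - {x}" using a lobe_sub(1)[OF a(2)] by (auto simp: lobe_def)
    have "\<Union>{Q'. lobe a Q'} \<subseteq> Q - {a}" using nested_lobe[OF less.prems a(2,1)] by blast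
    then have "\<Union>{Q'. lobe a Q'} \<subset> \<Union>{Q. lobe w Q}" using a by blast
    then show "lobes_constant a" using less.hyps[OF _ aH] psubset_card_mono[OF fin] by blast
  qed
  have lobe_const: "L a = L b" if "lobe w Q" "a \<in> Q" "b \<in> Q" for a b Q
  proof (rule connected_set_const[OF _ _ that(2,3)])
    show "connected_set Q" using that(1) by (simp add: lobe_def)
    show "L u = L v" if "u \<in> Q" "v \<in> Q" "E u v" for u v
      using edge_constant[OF IH(2,1) IH(2,1) that(3)] that \<open>lobe w Q\<close> by blast
  qed
  have c_in: "c \<in> L a" if "lobe w Q" "a \<in> Q" for a Q
    using lobe_nbr_y[OF less.prems that(1)] c_in_nbr lobe_const[OF that(1)] that(2) by blast
  have wV: "w \<in> V" "w \<in> C" using less.prems H_R by auto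
  show ?case
    unfolding lobes_constant_def
  proof (intro allI impI ballI, rule ccontr)
    fix Q u assume Q: "lobe w Q" "u \<in> Q" and ne: "L u \<noteq> L w"
    obtain b where b: "b \<in> Q" "E w b" using lobe_nbr[OF less.prems Q(1)] by blast
    have bH: "b \<in> H - {x}" and bV: "b \<in> V" using IH(2)[OF b(1) Q(1)] H_R(4) by auto
    have ne': "L w \<noteq> L b" using ne lobe_const[OF Q(1,2) b(1)] by simp
    \<comment> \<open>Otherwise a color of \<open>L b\<close> missing from \<open>L w\<close> would
      force \<open>b\<close> to have color \<open>c\<close> as well.\<close>
    have "\<phi> w \<noteq> c"
    proof
      assume w: "\<phi> w = c"
      obtain \<delta> where \<delta>: "\<delta> \<in> L b" "\<delta> \<notin> L w" using list_diff_nonempty[OF bV wV(1) ne'[symmetric]] by blast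
      have "\<delta> \<noteq> c" using \<delta>(2) w col_in[OF \<phi> wV(1)] by blast
      then have "\<phi> b = c"
        using forced[OF bH IH(1)[OF b(1) Q(1)] sym[OF b(2)] _ \<delta> _ \<phi>_Cls] less.prems by blast
      then show False using w col_ne[OF \<phi> wV(1) bV b(2)] by simp
    qed
    obtain \<gamma> where \<gamma>: "\<gamma> \<in> L w" "\<gamma> \<notin> L b" using list_diff_nonempty[OF wV(1) bV ne'] by blast
    have \<gamma>c: "\<gamma> \<noteq> c" using \<gamma>(2) c_in[OF Q(1) b(1)] by blast
    \<comment> \<open>The blocking lobe may differ from \<open>Q\<close>, but its list is constant
      too. It excludes \<open>\<phi> w\<close> from that list unless \<open>\<phi> w = c\<close>,
      whereas \<open>w\<close> is not a misfit against \<open>b2\<close>.\<close>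
    obtain Q2 where Q2: "lobe w Q2" "\<not> unblocked w \<gamma> Q2"
      using blocking_lobe[OF less.prems b(2) _ \<gamma>] \<gamma>c bH by blast
    obtain b2 where b2: "b2 \<in> Q2" "E w b2" using lobe_nbr[OF less.prems Q2(1)] by blast
    have "\<phi> w \<notin> L b2 - {c}"
      using blocked_all[OF less.prems Q2(1) _ Q2(2) \<gamma>c \<phi>_Cls] lobe_const[OF Q2(1) _ b2(1)] by blast
    then show False using \<open>\<phi> w \<noteq> c\<close> fitD[OF \<phi>_Cls wV(2) b2(2)] by blast
  qed
qed

text \<open>For edges at \<open>x\<close> the color missing from \<open>L x\<close> cannot be
  \<open>c\<close>, so the other end is forced to have color \<open>c\<close>; but no neighbor of
  \<open>x\<close> in \<open>C\<close> besides \<open>y\<close> has this color.\<close>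

private lemma constant_on_H: "v \<in> H \<Longrightarrow> L v = L x"
proof (rule connected_set_const[OF connected_H _ _ H_R(3)])
  have x_edge: "L a = L x" if a: "a \<in> H - {x}" "E a x" for a
  proof (rule ccontr)
    assume "L a \<noteq> L x"
    moreover have "a \<in> V" using a H_R(4) by blast
    ultimately obtain \<gamma> where \<gamma>: "\<gamma> \<in> L a" "\<gamma> \<notin> L x" using list_diff_nonempty[OF _ basics(1)] by blast
    have "\<phi> a = c" using forced[OF a(1) all_lobes_constant[OF a(1)] a(2) H_R(3) \<gamma> _ \<phi>_Cls] \<gamma>(2) cx by blast
    then show False using tight[OF \<phi>_Cls _ _ sym[OF a(2)]] a(1) H_R(8) by blast
  qed
  fix a b assume ab: "a \<in> H" "b \<in> H" "E a b"
  consider "a = x" | "b = x" | "a \<noteq> x" "b \<noteq> x" by blast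
  then show "L a = L b"
  proof cases
    case 1
    then have "b \<in> H - {x}" "E b x" using ab irrefl sym[OF ab(3)] by auto
    then show ?thesis using x_edge 1 by simp
  next
    case 2
    then have "a \<in> H - {x}" "E a x" using ab irrefl by auto
    then show ?thesis using x_edge 2 by simp
  next
    case 3
    then have "a \<in> H - {x}" "b \<in> H - {x}" using ab by auto
    then show ?thesis using edge_constant all_lobes_constant ab(3) by blast
  qed
qed

text \<open>All neighbors of \<open>y\<close> lie in \<open>H\<close>, where every list is
  \<open>L x\<close>; so a color of \<open>L y\<close> outside \<open>L x\<close> is free at
  \<open>y\<close> and makes it a misfit against \<open>x\<close>.\<close>

private lemma recolor_y:
  assumes "L y \<noteq> L x"
  shows "\<exists>\<psi>. \<psi> \<in> col V L \<and> eqv V L \<phi> \<psi> \<and> misfit C \<psi>"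
proof -
  obtain \<gamma> where \<gamma>: "\<gamma> \<in> L y" "\<gamma> \<notin> L x" using list_diff_nonempty[OF basics(9,1) assms] by blast
  have st: "(\<phi>, \<phi>(y := \<gamma>)) \<in> step V L"
  proof (rule recolor_step[OF \<phi> basics(9) \<gamma>(1)])
    fix u assume u: "u \<in> V" "E y u"
    have "u \<in> H" using leaf_adj[OF l y(1) u(2)] u(2) irrefl by (auto simp: H_def)
    then show "\<phi> u \<noteq> \<gamma>" using constant_on_H col_in[OF \<phi> u(1)] \<gamma>(2) by auto
  qed
  have "misfit C (\<phi>(y := \<gamma>))"
    using y(1) sym[OF y(2)] \<gamma>(2) unfolding misfit_def by (metis fun_upd_same)
  then show ?thesis using step_col[OF st] r_into_rtrancl[OF st] by blast
qed

lemma to_misfit_if_tight: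
  assumes "\<exists>v \<in> C. L v \<noteq> L x"
  shows "\<exists>\<psi>. \<psi> \<in> col V L \<and> eqv V L \<phi> \<psi> \<and> misfit C \<psi>"
proof (rule recolor_y)
  obtain v where "v \<in> C" "L v \<noteq> L x" using assms by blast
  then show "L y \<noteq> L x" using constant_on_H[of v] by (cases "v = y") (auto simp: H_def)
qed

end

text \<open>A second neighbor of \<open>x\<close> in \<open>C\<close> with the color
  \<open>c\<close> of \<open>y\<close> would give slack at \<open>x\<close> from inside the leaf; if
  this never occurs, the lists on \<open>H\<close> are constant.\<close>

lemma to_misfit_if_shared_color:
  assumes "\<exists>v \<in> C. L v \<noteq> L x"
  shows "\<exists>\<psi>. \<psi> \<in> col V L \<and> eqv V L \<phi> \<psi> \<and> (misfit C \<psi> \<or> slack V L C \<psi> x)"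
proof (rule ccontr)
  assume neg: "\<not> ?thesis"
  have fit: "\<not> misfit C \<psi>" and sl: "\<not> slack V L C \<psi> x" if "\<psi> \<in> Cls" for \<psi>
    using neg Cls_equivalent[OF that] Cls_col[OF that] by blast+
  have "\<psi> a \<noteq> c" if "\<psi> \<in> Cls" "a \<in> C" "a \<noteq> y" "E x a" for \<psi> a
    using sl[OF that(1)] that y Cls_y[OF that(1)] unfolding slack_def by metis
  then show False using to_misfit_if_tight[OF fit _ assms] neg by blast
qed

end

lemma to_misfit:
  assumes n: "nonconstant_leaf x C" "nonconstant_leaf x' C'"
    and disj: "C \<inter> C' = {}" "x \<notin> C'" and \<phi>: "\<phi> \<in> col V L"
  shows "\<exists>\<psi>. \<psi> \<in> col V L \<and> eqv V L \<phi> \<psi> \<and> misfit (C \<union> C') \<psi>"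
proof (rule ccontr)
  assume neg: "\<not> ?thesis"
  have mono: "misfit (C \<union> C') \<psi>" if "misfit C \<psi> \<or> misfit C' \<psi>" for \<psi>
    using that by (auto simp: misfit_def)
  have l: "leaf x C" using n by (simp add: nonconstant_leaf_def)
  have xC: "x \<in> V" "C \<subseteq> V" "x \<notin> C" using l leaf_subset[OF l] by (auto simp: leaf_def)
  have out: "\<not> slack V L (V - insert x C) \<phi> x"
    using to_misfit_if_slack_outside[OF n(1) \<phi>] neg mono by blast
  have inside: "\<not> slack V L C \<psi> x" if "\<psi> \<in> col V L" "eqv V L \<phi> \<psi>" for \<psi>
    using to_misfit_if_slack_inside[OF l n(2) disj that(1)] neg mono eqv_trans[OF that(2)] by blast
  have no_mis: "\<not> misfit C \<phi>" using neg mono \<phi> by blast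
  \<comment> \<open>A neighbor of \<open>x\<close> with a color outside \<open>L x\<close> is a
    misfit if it lies in \<open>C\<close>, and gives slack at \<open>x\<close> if it lies
    outside.\<close>
  have Lx: "\<phi> r \<in> L x" if "E x r" for r
  proof (cases "r \<in> C")
    case True
    then show ?thesis using no_mis sym[OF that] by (auto simp: misfit_def)
  next
    case False
    then have "r \<in> V - insert x C" using adj_V[OF sym[OF that]] that irrefl by auto
    then show ?thesis using out that by (auto simp: slack_def)
  qed
  \<comment> \<open>The \<open>k\<close> neighbors of \<open>x\<close> use colors of
    \<open>L x\<close> other than \<open>\<phi> x\<close>, of which there are
    \<open>k - 1\<close>.\<close>
  have "\<not> inj_on \<phi> (nbrs V x)"
  proof
    assume "inj_on \<phi> (nbrs V x)"
    moreover have "\<phi> ` nbrs V x \<subseteq> L x - {\<phi> x}"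
    proof
      fix d assume "d \<in> \<phi> ` nbrs V x"
      then obtain r where r: "r \<in> V" "E x r" "d = \<phi> r" by (auto simp: nbrs_def)
      then show "d \<in> L x - {\<phi> x}" using Lx[OF r(2)] col_ne[OF \<phi> xC(1) r(1,2)] by auto
    qed
    ultimately have "card (nbrs V x) \<le> card (L x - {\<phi> x})"
      using finite_L[OF xC(1)] card_inj_on_le by blast
    also have "\<dots> < card (L x)"
      using finite_L[OF xC(1)] col_in[OF \<phi> xC(1)] by (rule card_Diff1_less)
    finally show False using card_nbrs[OF xC(1)] card_L[OF xC(1)] by simp
  qed
  then obtain r r' where r: "r \<in> V" "r' \<in> V" "E x r" "E x r'" "r \<noteq> r'" "\<phi> r = \<phi> r'"
    unfolding inj_on_def nbrs_def by blast
  have B: "r \<in> C \<or> r \<in> V - insert x C" "r' \<in> C \<or> r' \<in> V - insert x C" using r irrefl by auto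
  have "\<not> (r \<in> C \<and> r' \<in> C)" using inside[OF \<phi>] r unfolding slack_def by blast
  moreover have "\<not> (r \<in> V - insert x C \<and> r' \<in> V - insert x C)" using out r unfolding slack_def by blast
  ultimately obtain y z where yz: "y \<in> C" "E x y" "z \<in> V - insert x C" "E x z" "\<phi> z = \<phi> y"
    using B r by metis
  have "\<exists>v \<in> C. L v \<noteq> L x" using n(1) by (simp add: nonconstant_leaf_def)
  from to_misfit_if_shared_color[OF l \<phi> yz(1-4) refl yz(5) Lx[OF yz(2)] this]
  show False using inside neg mono by blast
qed

theorem swappable_if_cut:
  assumes x0: "x0 \<in> V" and A: "A \<noteq> {}" "closed_in (V - {x0}) A" "A \<noteq> V - {x0}"
  shows "col V L \<noteq> {} \<and> (\<forall>\<phi> \<in> col V L. \<forall>\<psi> \<in> col V L. eqv V L \<phi> \<psi>)"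
proof -
  let ?A' = "V - {x0} - A"
  have AV: "A \<subseteq> V - {x0}" using A by (simp add: closed_in_def)
  obtain x C where l: "leaf x C" "C \<subseteq> A" "x \<in> insert x0 A"
    using leaf_exists[OF x0 A(1,2)] A(3) AV by blast
  obtain x' C' where l': "leaf x' C'" "C' \<subseteq> ?A'" "x' \<in> insert x0 ?A'"
  proof (rule leaf_exists[OF x0 _ closed_in_Diff[OF A(2)]])
    show "?A' \<noteq> {}" using A(3) AV by blast
    show "insert x0 ?A' \<noteq> V" using A(1) AV by blast
  qed
  \<comment> \<open>The roots may coincide at \<open>x0\<close>, but neither lies in the other leaf
    set.\<close>
  have disj: "C \<inter> C' = {}" "x \<notin> C'" "x' \<notin> C" using l l' AV by blast+
  show ?thesis
  proof (cases "nonconstant_leaf x C \<and> nonconstant_leaf x' C'")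
    case False
    then consider "\<And>v. v \<in> C \<Longrightarrow> L v = L x" | "\<And>v. v \<in> C' \<Longrightarrow> L v = L x'"
      using l(1) l'(1) unfolding nonconstant_leaf_def by blast
    then show ?thesis
    proof cases
      case 1
      show ?thesis using constant_leaf_colorable[OF l(1) 1] constant_leaf_equivalent[OF l(1) 1] by blast
    next
      case 2
      show ?thesis using constant_leaf_colorable[OF l'(1) 2] constant_leaf_equivalent[OF l'(1) 2] by blast
    qed
  next
    case True
    then have n: "nonconstant_leaf x C" "nonconstant_leaf x' C'" by blast+
    have "eqv V L \<phi> \<psi>" if \<phi>: "\<phi> \<in> col V L" and \<psi>: "\<psi> \<in> col V L" for \<phi> \<psi>
    proof -
      obtain \<phi>' where \<phi>': "\<phi>' \<in> col V L" "eqv V L \<phi> \<phi>'" "misfit (C \<union> C') \<phi>'"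
        using to_misfit[OF n disj(1,2) \<phi>] by blast
      obtain \<psi>' where \<psi>': "\<psi>' \<in> col V L" "eqv V L \<psi> \<psi>'" "misfit (C \<union> C') \<psi>'"
        using to_misfit[OF n disj(1,2) \<psi>] by blast
      have "eqv V L \<phi>' \<psi>'" by (rule misfits_equivalent[OF n disj \<phi>'(1,3) \<psi>'(1,3)])
      from eqv_trans[OF eqv_trans[OF \<phi>'(2) this] eqv_sym[OF \<psi>'(2)]] show ?thesis .
    qed
    then show ?thesis using misfit_exists[OF n(1)] by blast
  qed
qed

end

section \<open>Transfer to digraphs\<close>

sublocale graph \<subseteq> adj: sym_irrefl "dominates G"
  by unfold_locales (auto intro: arcs_ends_symmetric dest: adj_not_same)

context graph
begin

lemma dominates_induce_iff: "u \<rightarrow>\<^bsub>G \<restriction> W\<^esub> v \<longleftrightarrow> u \<rightarrow> v \<and> u \<in> W \<and> v \<in> W"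
  by (auto simp: arcs_ends_conv)

lemma symmetric_induce: "symmetric (G \<restriction> W)"
  unfolding symmetric_def sym_def dominates_induce_iff by (auto intro: adj.sym)

lemma closed_in_reachable: "u \<in> W \<Longrightarrow> adj.closed_in W {v. u \<rightarrow>\<^sup>*\<^bsub>G \<restriction> W\<^esub> v}"
proof -
  interpret H: wf_digraph "G \<restriction> W" by auto
  assume u: "u \<in> W"
  have "v \<in> W" if "u \<rightarrow>\<^sup>*\<^bsub>G \<restriction> W\<^esub> v" for v using H.reachable_in_verts(2)[OF that] by simp
  moreover have "u \<rightarrow>\<^sup>*\<^bsub>G \<restriction> W\<^esub> t" if "u \<rightarrow>\<^sup>*\<^bsub>G \<restriction> W\<^esub> s" "t \<in> W" "s \<rightarrow> t" for s t
    using that calculation[OF that(1)] by (intro H.reachable_adj_trans[OF that(1)]) (simp add: dominates_induce_iff)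
  ultimately show ?thesis unfolding adj.closed_in_def by blast
qed

lemma reachable_in_closed:
  assumes "u \<rightarrow>\<^sup>*\<^bsub>G \<restriction> W\<^esub> v" "adj.closed_in W K" "u \<in> K"
  shows "v \<in> K"
proof -
  interpret H: wf_digraph "G \<restriction> W" by auto
  show ?thesis
    using assms(1)
  proof (induction rule: H.reachable_induct)
    case base
    then show ?case using assms(3) by blast
  next
    case (step s t)
    then show ?case using assms(2) unfolding adj.closed_in_def dominates_induce_iff by blast
  qed
qed

text \<open>Reachability classes are closed, and closed sets are closed under reachability. The null
  graph is excluded because the library does not call it connected.\<close>

lemma connected_induce_iff:
  assumes "W \<noteq> {}"
  shows "connected (G \<restriction> W) \<longleftrightarrow> adj.connected_set W"
proof -
  interpret H: wf_digraph "G \<restriction> W" by auto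
  have "connected (G \<restriction> W) \<longleftrightarrow> (\<forall>u \<in> W. \<forall>v \<in> W. u \<rightarrow>\<^sup>*\<^bsub>G \<restriction> W\<^esub> v)"
    using assms H.reachable_mk_symmetric_eq[OF symmetric_induce]
    by (simp add: connected_def strongly_connected_def)
  also have "\<dots> \<longleftrightarrow> adj.connected_set W"
  proof
    assume reach: "\<forall>u \<in> W. \<forall>v \<in> W. u \<rightarrow>\<^sup>*\<^bsub>G \<restriction> W\<^esub> v"
    show "adj.connected_set W"
      unfolding adj.connected_set_def
    proof (intro allI impI)
      fix S assume S: "S \<noteq> {}" "adj.closed_in W S"
      have sub: "S \<subseteq> W" using S(2) by (simp add: adj.closed_in_def)
      obtain u where u: "u \<in> S" using S(1) by blast
      have "v \<in> S" if "v \<in> W" for v using reachable_in_closed[OF _ S(2) u] reach u sub that by blast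
      then show "S = W" using sub by blast
    qed
  next
    assume conn: "adj.connected_set W"
    have "u \<rightarrow>\<^sup>*\<^bsub>G \<restriction> W\<^esub> v" if "u \<in> W" "v \<in> W" for u v
    proof -
      have "u \<in> {v. u \<rightarrow>\<^sup>*\<^bsub>G \<restriction> W\<^esub> v}" using that(1) by simp
      then have "{v. u \<rightarrow>\<^sup>*\<^bsub>G \<restriction> W\<^esub> v} = W"
        using adj.connected_setD[OF conn _ closed_in_reachable[OF that(1)]] by blast
      then show ?thesis using that(2) by blast
    qed
    then show "\<forall>u \<in> W. \<forall>v \<in> W. u \<rightarrow>\<^sup>*\<^bsub>G \<restriction> W\<^esub> v" by blast
  qed
  finally show ?thesis .
qed

lemma card_nbrs_eq_out_degree: "card (adj.nbrs (verts G) v) = out_degree G v"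
proof -
  have "head G ` out_arcs G v = adj.nbrs (verts G) v"
    unfolding adj.nbrs_def by (auto simp: out_arcs_def arcs_ends_conv image_iff)
  moreover have "inj_on (head G) (out_arcs G v)"
    by (rule inj_onI) (auto simp: out_arcs_def arc_to_ends_def intro: no_multi_arcs)
  ultimately show ?thesis unfolding out_degree_def by (metis card_image)
qed

section \<open>Steps as sequences of Kempe swaps\<close>

lemma kempe_component_eq:
  "kempe_component G \<phi> \<alpha> \<beta> u = {v. u \<rightarrow>\<^sup>*\<^bsub>G \<restriction> {v \<in> verts G. \<phi> v \<in> {\<alpha>, \<beta>}}\<^esub> v}"
  unfolding kempe_component_def pre_digraph.scc_of_def
  using symmetric_reachable[OF symmetric_induce] by blast

lemma list_colorings_iff: "\<phi> \<in> list_colorings G L \<longleftrightarrow> \<phi> \<in> adj.col (verts G) L \<and> \<phi> \<in> extensional (verts G)"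
  using adj_in_verts unfolding list_colorings_def adj.col_def PiE_iff by auto

text \<open>The Kempe components that make up \<open>K\<close> are swapped one at a time; no swap
  changes the set of vertices colored from the pair, so the remaining ones stay closed.\<close>

lemma closed_swap_equivalent:
  assumes "finite K" "\<phi> \<in> list_colorings G L"
    and "adj.closed_in {v \<in> verts G. \<phi> v \<in> {\<alpha>, \<beta>}} K"
    and "\<And>v. v \<in> K \<Longrightarrow> transpose \<alpha> \<beta> (\<phi> v) \<in> L v"
  shows "list_equivalent G L \<phi> (\<lambda>v. if v \<in> K then transpose \<alpha> \<beta> (\<phi> v) else \<phi> v)"
  using assms
proof (induction K arbitrary: \<phi> rule: finite_psubset_induct)
  case (psubset K)
  let ?U = "{v \<in> verts G. \<phi> v \<in> {\<alpha>, \<beta>}}"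
  show ?case
  proof (cases "K = {}")
    case True
    then show ?thesis by (simp add: list_equivalent_def)
  next
    case False
    then obtain u where u: "u \<in> K" by blast
    define Q where "Q = kempe_component G \<phi> \<alpha> \<beta> u"
    define \<psi> where "\<psi> = kempe_swap G \<alpha> \<beta> u \<phi>"
    have uU: "u \<in> ?U" using u psubset.prems(2) unfolding adj.closed_in_def by blast
    have cl: "adj.closed_in ?U Q" unfolding Q_def kempe_component_eq by (rule closed_in_reachable[OF uU])
    have uQ: "u \<in> Q"
    proof -
      interpret H: wf_digraph "G \<restriction> ?U" by auto
      have "u \<in> verts (G \<restriction> ?U)" using uU by simp
      then show ?thesis unfolding Q_def kempe_component_eq by blast
    qed
    have QK: "Q \<subseteq> K"
      using reachable_in_closed[OF _ psubset.prems(2) u] unfolding Q_def kempe_component_eq by blast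
    have QV: "Q \<subseteq> verts G" using cl unfolding adj.closed_in_def by blast
    have \<psi>: "\<psi> v = (if v \<in> Q then transpose \<alpha> \<beta> (\<phi> v) else \<phi> v)" for v
      by (simp add: \<psi>_def kempe_swap_def Q_def)
    have col: "\<phi> \<in> adj.col (verts G) L" "\<phi> \<in> extensional (verts G)"
      using psubset.prems(1) by (simp_all add: list_colorings_iff)
    have "(\<phi>, \<psi>) \<in> adj.step (verts G) L"
      using adj.stepI[OF col(1) cl] psubset.prems(3) QK \<psi> by blast
    then have "\<psi> \<in> adj.col (verts G) L" by (rule adj.step_col)
    moreover have "\<psi> \<in> extensional (verts G)" using col(2) QV \<psi> by (auto simp: extensional_def)
    ultimately have \<psi>G: "\<psi> \<in> list_colorings G L" by (simp add: list_colorings_iff)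
    have st: "(\<phi>, \<psi>) \<in> valid_swaps G L"
      using psubset.prems(1) \<psi>G uU unfolding valid_swaps_def \<psi>_def by blast
    have "\<psi> v \<in> {\<alpha>, \<beta>} \<longleftrightarrow> \<phi> v \<in> {\<alpha>, \<beta>}" for v using \<psi>[of v] by (auto simp: transpose_eq_iff)
    then have U: "{v \<in> verts G. \<psi> v \<in> {\<alpha>, \<beta>}} = ?U" by simp
    have "list_equivalent G L \<psi> (\<lambda>v. if v \<in> K - Q then transpose \<alpha> \<beta> (\<psi> v) else \<psi> v)"
    proof (rule psubset.IH)
      show "K - Q \<subset> K" using uQ u by blast
      show "\<psi> \<in> list_colorings G L" by (rule \<psi>G)
      have "s \<in> K - Q \<Longrightarrow> t \<in> ?U \<Longrightarrow> s \<rightarrow> t \<Longrightarrow> t \<in> K - Q" for s t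
        using psubset.prems(2) cl adj.sym[of s t] unfolding adj.closed_in_def by blast
      moreover have "K - Q \<subseteq> ?U" using psubset.prems(2) unfolding adj.closed_in_def by blast
      ultimately show "adj.closed_in {v \<in> verts G. \<psi> v \<in> {\<alpha>, \<beta>}} (K - Q)"
        unfolding U adj.closed_in_def by blast
      show "transpose \<alpha> \<beta> (\<psi> v) \<in> L v" if "v \<in> K - Q" for v using psubset.prems(3) \<psi>[of v] that by simp
    qed
    moreover have "(\<lambda>v. if v \<in> K - Q then transpose \<alpha> \<beta> (\<psi> v) else \<psi> v) =
        (\<lambda>v. if v \<in> K then transpose \<alpha> \<beta> (\<phi> v) else \<phi> v)"
      using QK \<psi> by (auto simp: fun_eq_iff)
    ultimately show ?thesis
      using converse_rtrancl_into_rtrancl[OF st] by (simp add: list_equivalent_def)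
  qed
qed

lemma list_equivalent_if_eqv:
  assumes "adj.eqv (verts G) L \<phi> \<psi>"
  shows "list_equivalent G L (restrict \<phi> (verts G)) (restrict \<psi> (verts G))"
  using assms
proof (induction rule: rtrancl_induct)
  case base
  then show ?case by (simp add: list_equivalent_def)
next
  case (step \<psi>1 \<psi>2)
  let ?r = "\<lambda>\<phi>. restrict \<phi> (verts G)"
  obtain \<alpha> \<beta> K where \<psi>: "\<psi>1 \<in> adj.col (verts G) L" "\<psi>2 \<in> adj.col (verts G) L"
    and K: "adj.closed_in {v \<in> verts G. \<psi>1 v \<in> {\<alpha>, \<beta>}} K"
    and eq: "\<forall>v \<in> verts G. \<psi>2 v = (if v \<in> K then transpose \<alpha> \<beta> (\<psi>1 v) else \<psi>1 v)"
    using step.hyps(2) unfolding adj.step_def by blast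
  have KV: "K \<subseteq> verts G" using K unfolding adj.closed_in_def by blast
  have "{v \<in> verts G. ?r \<psi>1 v \<in> {\<alpha>, \<beta>}} = {v \<in> verts G. \<psi>1 v \<in> {\<alpha>, \<beta>}}" by auto
  with K have "adj.closed_in {v \<in> verts G. ?r \<psi>1 v \<in> {\<alpha>, \<beta>}} K" by simp
  moreover have "?r \<psi>1 \<in> list_colorings G L"
    using \<psi>(1) adj.col_cong[of "verts G" "?r \<psi>1" \<psi>1 L] by (simp add: list_colorings_iff)
  moreover have "transpose \<alpha> \<beta> (?r \<psi>1 v) \<in> L v" if "v \<in> K" for v
    using that KV eq adj.col_in[OF \<psi>(2), of v] by auto
  ultimately have "list_equivalent G L (?r \<psi>1) (\<lambda>v. if v \<in> K then transpose \<alpha> \<beta> (?r \<psi>1 v) else ?r \<psi>1 v)"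
    using KV finite_verts finite_subset by (intro closed_swap_equivalent) blast+
  moreover have "(\<lambda>v. if v \<in> K then transpose \<alpha> \<beta> (?r \<psi>1 v) else ?r \<psi>1 v) = ?r \<psi>2"
    using eq KV by (auto simp: fun_eq_iff)
  ultimately have "list_equivalent G L (?r \<psi>1) (?r \<psi>2)" by simp
  with step.IH show ?case unfolding list_equivalent_def by (rule rtrancl_trans)
qed

lemma list_swappable_if_col:
  assumes "adj.col (verts G) L \<noteq> {} \<and>
    (\<forall>\<phi> \<in> adj.col (verts G) L. \<forall>\<psi> \<in> adj.col (verts G) L. adj.eqv (verts G) L \<phi> \<psi>)"
  shows "list_swappable G L"
  unfolding list_swappable_def
proof (intro conjI ballI)
  obtain \<phi> where "\<phi> \<in> adj.col (verts G) L" using assms by blast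
  then have "restrict \<phi> (verts G) \<in> list_colorings G L"
    using adj.col_cong[of "verts G" "restrict \<phi> (verts G)" \<phi> L] by (simp add: list_colorings_iff)
  then show "list_colorings G L \<noteq> {}" by blast
  fix \<phi> \<psi> assume "\<phi> \<in> list_colorings G L" "\<psi> \<in> list_colorings G L"
  then have "adj.eqv (verts G) L \<phi> \<psi>" "\<phi> \<in> extensional (verts G)" "\<psi> \<in> extensional (verts G)"
    using assms by (auto simp: list_colorings_iff)
  then show "list_equivalent G L \<phi> \<psi>"
    using list_equivalent_if_eqv[of \<phi> \<psi> L] by (simp add: extensional_restrict)
qed

end


theorem theorem1:
  fixes G :: "('a, 'b) pre_digraph" and k :: nat
  assumes "k \<ge> 3"
    and "graph G"
    and "regular_graph G k"
    and "vertex_connectivity G = 1"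
  shows "k_swappable TYPE('c) k G"
proof -
  interpret graph G by fact
  let ?V = "verts G"
  define P where "P n \<longleftrightarrow> (\<exists>S \<subseteq> ?V. card S = n \<and>
     (\<not> connected (G \<restriction> (?V - S)) \<or> card (?V - S) = 1))" for n
  have least: "vertex_connectivity G = (LEAST n. P n)"
    by (simp add: vertex_connectivity_def P_def)
  \<comment> \<open>Removing all vertices leaves the null graph, so the minimum is taken over a
    nonempty set.\<close>
  have "P (card ?V)"
    unfolding P_def by (intro exI[of _ ?V]) (simp add: connected_def strongly_connected_def)
  then have "P 1" using LeastI[of P "card ?V"] assms(4) least by simp
  moreover have "\<not> P 0" using not_less_Least[of 0 P] assms(4) least by simp
  then have "connected (G \<restriction> ?V)" unfolding P_def by (metis Diff_empty card.empty empty_subsetI)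
  then have conn: "adj.connected_set ?V" and V_ne: "?V \<noteq> {}"
    using connected_induce_iff[of ?V] by (auto simp: connected_def strongly_connected_def)
  have deg: "card (adj.nbrs ?V v) = k" if "v \<in> ?V" for v
    using assms(3) that by (simp add: card_nbrs_eq_out_degree regular_graph_def)
  obtain x where x: "x \<in> ?V" "\<not> connected (G \<restriction> (?V - {x})) \<or> card (?V - {x}) = 1"
    using \<open>P 1\<close> unfolding P_def by (metis One_nat_def card_1_singletonE insert_subset)
  \<comment> \<open>The neighbors of \<open>x\<close> survive its removal, which rules out that a
    single vertex is left; so \<open>x\<close> is a cut vertex.\<close>
  have "adj.nbrs ?V x \<subseteq> ?V - {x}" using adj.irrefl by (auto simp: adj.nbrs_def)
  then have "k \<le> card (?V - {x})" using deg[OF x(1)] by (metis card_mono finite_Diff finite_verts)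
  then have card: "card (?V - {x}) \<ge> 3" using assms(1) by (rule le_trans[rotated])
  have big: "card (?V - {x}) \<noteq> 1" using card by simp
  have ne: "?V - {x} \<noteq> {}" using card by (metis card.empty not_numeral_le_zero)
  have "\<not> adj.connected_set (?V - {x})" using x(2) big unfolding connected_induce_iff[OF ne] by blast
  then obtain A where A: "A \<noteq> {}" "adj.closed_in (?V - {x}) A" "A \<noteq> ?V - {x}"
    unfolding adj.connected_set_def by blast
  have "list_swappable G L" if "k_assignment G k L" for L :: "'a \<Rightarrow> 'c set"
  proof -
    interpret regular_lists "dominates G" ?V L k
      using that conn deg adj_in_verts by unfold_locales (auto simp: k_assignment_def)
    show ?thesis by (rule list_swappable_if_col[OF swappable_if_cut[OF x(1) A]])
  qed
  then show ?thesis by (simp add: k_swappable_def)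
qed

end
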